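(* Let $f\colon\mathbb{R}\to\mathbb{R}$ be locally Lipschitz continuous and $u_0\in C^1_{\mathrm{ub}}(\mathbb{R})$. Suppose $u_0(x)\to\phi_\pm$ as $x\to\pm\infty$, where $\phi_+$ and $\phi_-$ are nonzero and have the same sign. Let $u\in C([0,\infty),C_{\mathrm{ub}}(\mathbb{R}))$ be the unique global mild solution of $u_t=u_{xx}+f(u)_x$ with $u(0,\cdot)=u_0$. Then there exists a time $T>0$ such that for all $t>T$ the function $u(t,\cdot)$ has no zeros.
   Context: $C_{\mathrm{ub}}(\mathbb{R})$ denotes the space of bounded, uniformly continuous functions $\mathbb{R}\to\mathbb{R}$ with the sup-norm, and $C^1_{\mathrm{ub}}(\mathbb{R})$ the space of $C^1$ functions $g$ with $g,g'\in C_{\mathrm{ub}}(\mathbb{R})$. A mild solution of $u_t=u_{xx}+f(u)_x$ with initial condition $u_0$ is a continuous curve $u\in C([0,\infty),C_{\mathrm{ub}}(\mathbb{R}))$ satisfying $$u(t,\cdot)=e^{\partial_x^2 t}u_0+\int_0^t\partial_x e^{\partial_x^2(t-s)}f(u(s,\cdot))\,ds,$$ where $(e^{\partial_x^2 t}g)(x)=\int_{\mathbb{R}}(4\pi t)^{-1/2}e^{-(x-y)^2/(4t)}g(y)\,dy$. Such a global mild solution exists and is unique for locally Lipschitz $f$ and $u_0\in C^1_{\mathrm{ub}}(\mathbb{R})$. *)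

theory Defs
  imports "HOL-Analysis.Analysis"
begin

definition C_ub :: "(real \<Rightarrow> real) \<Rightarrow> bool" where
  "C_ub g \<longleftrightarrow> bounded (range g) \<and> uniformly_continuous_on UNIV g"

definition C1_ub :: "(real \<Rightarrow> real) \<Rightarrow> bool" where
  "C1_ub g \<longleftrightarrow> (\<forall>x. g differentiable (at x)) \<and> C_ub g \<and> C_ub (deriv g)"

definition locally_lipschitz :: "(real \<Rightarrow> real) \<Rightarrow> bool" where
  "locally_lipschitz f \<longleftrightarrow> (\<forall>a b. \<exists>L. L-lipschitz_on {a..b} f)"

definition heat_kernel :: "real \<Rightarrow> real \<Rightarrow> real" where
  "heat_kernel t z = exp (- (z\<^sup>2) / (4 * t)) / sqrt (4 * pi * t)"

definition heat_sg :: "real \<Rightarrow> (real \<Rightarrow> real) \<Rightarrow> real \<Rightarrow> real" where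
  "heat_sg t g x = (LINT y|lborel. heat_kernel t (x - y) * g y)"

definition curve_C_ub :: "(real \<Rightarrow> real \<Rightarrow> real) \<Rightarrow> bool" where
  "curve_C_ub u \<longleftrightarrow> (\<forall>t\<ge>0. C_ub (u t)) \<and>
     (\<forall>t0\<ge>0. \<forall>e>0. \<exists>d>0. \<forall>t\<ge>0. \<bar>t - t0\<bar> < d \<longrightarrow> (\<forall>x. \<bar>u t x - u t0 x\<bar> \<le> e))"

text \<open>Mild solution of u_t = u_xx + f(u)_x with initial datum u0.\<close>
definition mild_solution :: "(real \<Rightarrow> real) \<Rightarrow> (real \<Rightarrow> real) \<Rightarrow> (real \<Rightarrow> real \<Rightarrow> real) \<Rightarrow> bool" where
  "mild_solution f u0 u \<longleftrightarrow> curve_C_ub u \<and> u 0 = u0 \<and>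
     (\<forall>t>0. \<forall>x. u t x = heat_sg t u0 x +
        (LBINT s:{0..t}. deriv (heat_sg (t - s) (\<lambda>y. f (u s y))) x))"

end

theory Submission
  imports Defs "HOL-Probability.Distributions"
begin

text \<open>
  Up to the symmetry \<open>u \<mapsto> - u\<close>, \<open>f \<mapsto> - f (- \<cdot>)\<close> both limits are positive. Fix a level \<open>c > 0\<close> below them and
  let \<open>w = max 0 (c - u)\<close>. The limits at infinity persist locally uniformly in time, so \<open>w\<close> is compactly
  supported in \<open>x\<close> on bounded time intervals. Testing the equation with \<open>w\<^sup>2\<close>, the flux drops out because
  \<open>w f(u) u\<^sub>x\<close> is an exact \<open>x\<close>-derivative, which leaves
  \<open>d/dt \<integral> w\<^sup>3 dx = - 6 \<integral> w u\<^sub>x\<^sup>2 dx\<close>. Hence on a time interval of length \<open>T\<close> some instant has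
  \<open>\<integral> w u\<^sub>x\<^sup>2 dx = O(1/T)\<close>, and there the interpolation inequality
  \<open>(sup w\<^sup>3)\<^sup>2 \<le> 9 (\<integral> w\<^sup>3 dx) (\<integral> w u\<^sub>x\<^sup>2 dx)\<close> makes \<open>w\<close> uniformly small, so \<open>u \<ge> c/2\<close>. Applied at the
  level \<open>c/2\<close>, the same identity shows that this bound persists.

  As \<open>f\<close> is merely Lipschitz, a mild solution need not be classical; the identity is proved, up to an error
  that vanishes with \<open>\<epsilon>\<close>, for the mollification of \<open>u(t)\<close> by the heat kernel at time \<open>\<epsilon>\<close>, which
  satisfies the equation with mollified flux in the classical sense.
\<close>

section \<open>Gaussian kernels\<close>

text \<open>The power in the test function is a matter of regularity: the square is the lowest
  integer power of the positive part that is differentiable, so products such as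
  \<open>w^2 u_x\<close> can be integrated by parts classically. The delicate point is the order of
  the choices. The support of \<open>w\<close> up to time \<open>T\<close> depends on
  \<open>T\<close>, while \<open>T\<close> must be computed from the energy. This is not circular,
  because the energy enters only at time 0, where \<open>c - u\<close> is positive only inside a
  fixed interval \<open>[-R0,R0]\<close>. The order is therefore: level and \<open>R0\<close>,
  initial energy, \<open>T\<close>, then \<open>R\<close>, and last the mollification, whose error
  may depend on all the others. Three levels are kept apart: the far field stays above
  \<open>3c/2\<close>, the gap is measured from \<open>c\<close>, and the bound reached is
  \<open>c/2\<close>. The first margin absorbs the mollification error at the ends of the spatial
  interval, the second leaves room for the gap at the good instant.\<close>

definition heat_kernel_dx :: "real \<Rightarrow> real \<Rightarrow> real" where
  "heat_kernel_dx t z = - (z / (2 * t)) * heat_kernel t z"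

definition heat_kernel_dxx :: "real \<Rightarrow> real \<Rightarrow> real" where
  "heat_kernel_dxx t z = (z\<^sup>2 / (4 * t\<^sup>2) - 1 / (2 * t)) * heat_kernel t z"

definition conv :: "(real \<Rightarrow> real) \<Rightarrow> (real \<Rightarrow> real) \<Rightarrow> real \<Rightarrow> real" where
  "conv K g x = (LINT y|lborel. K (x - y) * g y)"

lemma heat_sg_eq_conv: "heat_sg t g = conv (heat_kernel t) g"
  by (simp add: fun_eq_iff heat_sg_def conv_def)

lemma heat_kernel_eq_normal_density:
  "t > 0 \<Longrightarrow> heat_kernel t = normal_density 0 (sqrt (2 * t))"
  by (simp add: fun_eq_iff heat_kernel_def normal_density_def mult_ac)

lemma heat_kernel_nonneg [simp]: "t \<ge> 0 \<Longrightarrow> 0 \<le> heat_kernel t z"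
  by (simp add: heat_kernel_def)

lemma heat_kernel_measurable [measurable]:
  "(\<lambda>p. heat_kernel (fst p) (snd p)) \<in> borel_measurable borel"
  unfolding heat_kernel_def by (simp flip: borel_prod)

lemma integrable_heat_kernel: "t > 0 \<Longrightarrow> integrable lborel (heat_kernel t)"
  by (simp add: heat_kernel_eq_normal_density)

lemma integral_heat_kernel: "t > 0 \<Longrightarrow> (LINT z|lborel. heat_kernel t z) = 1"
  by (simp add: heat_kernel_eq_normal_density)

lemma second_moment_heat_kernel:
  assumes "t > 0"
  shows "has_bochner_integral lborel (\<lambda>z. heat_kernel t z * z\<^sup>2) (2 * t)"
  using normal_moment_even[of "sqrt (2 * t)" 0 1] assms
  by (simp add: heat_kernel_eq_normal_density fact_numeral)

lemma integrable_reflect_shift: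
  fixes K :: "real \<Rightarrow> real"
  assumes "integrable lborel K"
  shows "integrable lborel (\<lambda>y. K (x - y))"
  using lborel_integrable_real_affine[OF assms, of "-1" x] by simp

lemma integral_reflect_shift:
  fixes K :: "real \<Rightarrow> real"
  shows "(LINT y|lborel. K (x - y)) = (LINT z|lborel. K z)"
  using lborel_integral_real_affine[of "-1" K x] by simp

lemma conv_flip: "conv K g x = (LINT z|lborel. K z * g (x - z))"
  unfolding conv_def using integral_reflect_shift[of "\<lambda>z. K z * g (x - z)" x] by simp

section \<open>Derivatives of the heat kernel and their Gaussian bounds\<close>

lemma heat_kernel_has_derivative_x:
  assumes "t > 0"
  shows "(heat_kernel t has_real_derivative heat_kernel_dx t z) (at z)"
  unfolding heat_kernel_def [abs_def] heat_kernel_dx_def using assms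
  by (auto intro!: derivative_eq_intros simp: field_simps)

lemma heat_kernel_dx_has_derivative_x:
  assumes "t > 0"
  shows "(heat_kernel_dx t has_real_derivative heat_kernel_dxx t z) (at z)"
  unfolding heat_kernel_dx_def [abs_def] heat_kernel_dxx_def using assms
  by (auto intro!: derivative_eq_intros heat_kernel_has_derivative_x
      simp: heat_kernel_dx_def field_simps power2_eq_square)

text \<open>The same function \<open>heat_kernel_dxx\<close> is the second x-derivative, so this is
  the heat equation for the kernel.\<close>

lemma heat_kernel_has_derivative_t:
  assumes "t > 0"
  shows "((\<lambda>t. heat_kernel t z) has_real_derivative heat_kernel_dxx t z) (at t)"
proof -
  have s: "sqrt (4 * pi * t) * sqrt (4 * pi * t) = 4 * pi * t" "sqrt (4 * pi * t) > 0"
    using assms by auto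
  have e: "((\<lambda>t. exp (- z\<^sup>2 / (4 * t))) has_real_derivative
      exp (- z\<^sup>2 / (4 * t)) * (z\<^sup>2 / (4 * t\<^sup>2))) (at t)"
    using assms by (auto intro!: derivative_eq_intros simp: power2_eq_square field_simps)
  have q: "((\<lambda>t. sqrt (4 * pi * t)) has_real_derivative 4 * pi / (2 * sqrt (4 * pi * t))) (at t)"
  proof -
    have l: "((\<lambda>t. 4 * pi * t) has_real_derivative 4 * pi) (at t)"
      by (auto intro!: derivative_eq_intros)
    have p: "0 < 4 * pi * t" using assms by simp
    show ?thesis
      by (rule DERIV_cong[OF DERIV_chain2[OF DERIV_real_sqrt[OF p] l]]) (simp only: divide_inverse inverse_mult_distrib mult_ac)
  qed
  have "((\<lambda>t. heat_kernel t z) has_real_derivative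
     (exp (- z\<^sup>2 / (4 * t)) * (z\<^sup>2 / (4 * t\<^sup>2)) * sqrt (4 * pi * t)
       - exp (- z\<^sup>2 / (4 * t)) * (4 * pi / (2 * sqrt (4 * pi * t)))) / (4 * pi * t)) (at t)"
    unfolding heat_kernel_def using DERIV_divide[OF e q, unfolded s(1)] s(2) by linarith
  also have "(exp (- z\<^sup>2 / (4 * t)) * (z\<^sup>2 / (4 * t\<^sup>2)) * sqrt (4 * pi * t)
       - exp (- z\<^sup>2 / (4 * t)) * (4 * pi / (2 * sqrt (4 * pi * t)))) / (4 * pi * t)
     = heat_kernel_dxx t z"
  proof -
    define S where "S = sqrt (4 * pi * t)"
    have S: "4 * pi * t = S * S" "S > 0" using s by (simp_all add: S_def)
    have "4 * pi = S * S / t" using S(1) assms by (simp add: field_simps)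
    then show ?thesis
      unfolding heat_kernel_dxx_def heat_kernel_def S_def[symmetric] using S assms
      by (simp add: field_simps)
  qed
  finally show ?thesis .
qed

text \<open>Doubling the time in the majorant pays for the polynomial prefactors of the derivatives,
  and \<open>q\<close> records the blow-up at \<open>t = 0\<close>: 0, 1/2 and 1 for the kernel and
  its first two derivatives. Measurability is asked on the whole plane because the Duhamel integrand
  is later treated as a function of two variables without a sign condition on the time.\<close>

definition gaussian_family :: "(real \<Rightarrow> real \<Rightarrow> real) \<Rightarrow> bool" where
  "gaussian_family K \<longleftrightarrow>
     (\<lambda>p. K (fst p) (snd p)) \<in> borel_measurable borel \<and>
     continuous_on ({0<..} \<times> UNIV) (\<lambda>p. K (fst p) (snd p)) \<and>
     (\<exists>C\<ge>0. \<exists>q\<ge>0. \<forall>t>0. \<forall>z. \<bar>K t z\<bar> \<le> C * t powr (- q) * heat_kernel (2 * t) z)"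

text \<open>Half of the exponent is split off as a separate Gaussian factor; in the bounds below it
  is spent on the powers of \<open>z\<close>.\<close>

lemma heat_kernel_double:
  assumes "t > 0"
  shows "heat_kernel t z = sqrt 2 * exp (- (z\<^sup>2) / (8 * t)) * heat_kernel (2 * t) z"
proof -
  have "exp (- (z\<^sup>2) / (4 * t)) = exp (- (z\<^sup>2) / (8 * t)) * exp (- (z\<^sup>2) / (8 * t))"
    using assms by (simp flip: exp_add)
  moreover have "sqrt (4 * pi * (2 * t)) = sqrt 2 * sqrt (4 * pi * t)"
    using real_sqrt_mult[of 2 "4 * pi * t"] by (simp add: mult_ac)
  ultimately show ?thesis
    using assms by (simp add: heat_kernel_def del: real_sqrt_mult)
qed

lemma mult_exp_neg_le_1: "y * exp (- y) \<le> (1::real)"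
proof -
  have "y \<le> exp y" using exp_ge_add_one_self[of y] by linarith
  then show ?thesis by (simp add: exp_minus field_simps)
qed

lemma heat_kernel_bound:
  assumes "t > 0"
  shows "\<bar>heat_kernel t z\<bar> \<le> 2 * heat_kernel (2 * t) z"
proof -
  have s2: "sqrt 2 \<le> (2::real)" by (rule real_le_lsqrt) auto
  have "sqrt 2 * exp (- (z\<^sup>2) / (8 * t)) \<le> 2 * 1"
    using assms s2 by (intro mult_mono) auto
  then have "sqrt 2 * exp (- (z\<^sup>2) / (8 * t)) * heat_kernel (2 * t) z \<le> 2 * heat_kernel (2 * t) z"
    using assms by (intro mult_right_mono) auto
  then show ?thesis using assms heat_kernel_double[OF assms, of z] by simp
qed

lemma heat_kernel_dx_bound:
  assumes "t > 0"
  shows "\<bar>heat_kernel_dx t z\<bar> \<le> 2 * t powr (- (1/2)) * heat_kernel (2 * t) z"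
proof -
  \<comment> \<open>Scaled so that \<open>exp (- y^2)\<close> is exactly the spare Gaussian factor
    of \<open>heat_kernel_double\<close>; the estimate then reduces to
    \<open>y * exp (- y^2) \<le> 1\<close>.\<close>
  define y where "y = \<bar>z\<bar> / sqrt (8 * t)"
  have y2: "y\<^sup>2 = z\<^sup>2 / (8 * t)" using assms by (simp add: y_def power_divide)
  have y0: "y \<ge> 0" using assms by (simp add: y_def)
  have "y * exp (- (y\<^sup>2)) \<le> 1"
  proof -
    have "y \<le> 1 + y\<^sup>2"
      using sum_squares_ge_zero[of "y - 1" 0] zero_le_power2[of y] y0
      by (simp add: power2_eq_square algebra_simps)
    also have "\<dots> \<le> exp (y\<^sup>2)" by (rule exp_ge_add_one_self)
    finally show ?thesis by (simp add: exp_minus field_simps)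
  qed
  have s8: "sqrt (8 * t) = 2 * sqrt 2 * sqrt t"
    using real_sqrt_mult[of 4 2] by (simp add: real_sqrt_mult)
  have z: "\<bar>z\<bar> / (2 * t) = sqrt 2 * y * t powr (- (1/2))"
  proof -
    define a b where "a = sqrt t" and "b = sqrt (2::real)"
    have a: "a > 0" "b > 0" "t = a * a" "t powr (- (1/2)) = 1 / a" "y = \<bar>z\<bar> / (2 * b * a)"
      using assms by (auto simp: a_def b_def powr_minus_divide powr_half_sqrt y_def s8)
    have "\<bar>z\<bar> / (2 * (a * a)) = b * (\<bar>z\<bar> / (2 * b * a)) * (1 / a)"
      using a(1,2) by simp
    then show ?thesis unfolding a(4,5) b_def[symmetric] using a(3) by simp
  qed
  have "\<bar>heat_kernel_dx t z\<bar> = (\<bar>z\<bar> / (2 * t)) * (sqrt 2 * exp (- (y\<^sup>2)) * heat_kernel (2 * t) z)"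
    using assms y2 by (simp add: heat_kernel_dx_def abs_mult heat_kernel_double[OF assms, of z])
  also have "\<dots> = (y * exp (- (y\<^sup>2))) * (2 * t powr (- (1/2)) * heat_kernel (2 * t) z)"
    unfolding z by (simp add: algebra_simps)
  also have "\<dots> \<le> 1 * (2 * t powr (- (1/2)) * heat_kernel (2 * t) z)"
    using assms \<open>y * exp (- (y\<^sup>2)) \<le> 1\<close> by (intro mult_right_mono) auto
  finally show ?thesis by simp
qed

lemma heat_kernel_dxx_bound:
  assumes "t > 0"
  shows "\<bar>heat_kernel_dxx t z\<bar> \<le> 5 * t powr (- 1) * heat_kernel (2 * t) z"
proof -
  define y where "y = z\<^sup>2 / (8 * t)"
  have y0: "y \<ge> 0" using assms by (simp add: y_def)
  have e: "exp (- (z\<^sup>2) / (8 * t)) = exp (- y)" by (simp add: y_def)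
  have z: "z\<^sup>2 / (4 * t\<^sup>2) = 2 * y / t" using assms by (simp add: y_def power2_eq_square field_simps)
  have "2 * y / t \<ge> 0" "1 / (2 * t) \<ge> 0" using assms y0 by simp_all
  then have "\<bar>z\<^sup>2 / (4 * t\<^sup>2) - 1 / (2 * t)\<bar> \<le> 2 * y / t + 1 / (2 * t)"
    unfolding z by linarith
  also have "\<dots> = (2 * y + 1/2) / t" by (simp add: add_divide_distrib)
  finally have 1: "\<bar>z\<^sup>2 / (4 * t\<^sup>2) - 1 / (2 * t)\<bar> \<le> (2 * y + 1/2) / t" .
  have s2: "sqrt 2 \<le> (2::real)" by (rule real_le_lsqrt) auto
  have "exp (- y) \<le> 1" using y0 by simp
  moreover have "(2 * y + 1/2) * exp (- y) = 2 * (y * exp (- y)) + exp (- y) / 2"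
    by (simp add: algebra_simps)
  ultimately have 2: "(2 * y + 1/2) * exp (- y) \<le> 5/2"
    using mult_exp_neg_le_1[of y] by linarith
  have "\<bar>heat_kernel_dxx t z\<bar>
      = \<bar>z\<^sup>2 / (4 * t\<^sup>2) - 1 / (2 * t)\<bar> * (sqrt 2 * exp (- y) * heat_kernel (2 * t) z)"
    using assms by (simp add: heat_kernel_dxx_def abs_mult heat_kernel_double[OF assms, of z] e[symmetric])
  also have "\<dots> \<le> (2 * y + 1/2) / t * (2 * exp (- y) * heat_kernel (2 * t) z)"
    using assms y0 by (intro mult_mono[OF 1] mult_right_mono s2) auto
  also have "\<dots> = ((2 * y + 1/2) * exp (- y)) * (2 / t * heat_kernel (2 * t) z)"
    by (simp only: divide_inverse mult_ac)
  also have "\<dots> \<le> 5/2 * (2 / t * heat_kernel (2 * t) z)"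
    using assms by (intro mult_right_mono 2) auto
  finally show ?thesis using assms by (simp add: powr_minus_divide)
qed

lemma heat_kernel_continuous:
  "continuous_on ({0<..} \<times> UNIV) (\<lambda>p. heat_kernel (fst p) (snd p))"
  unfolding heat_kernel_def by (intro continuous_intros) auto

lemma gaussian_family_heat_kernel: "gaussian_family heat_kernel"
  unfolding gaussian_family_def
proof (intro conjI)
  show "\<exists>C\<ge>0. \<exists>q\<ge>0. \<forall>t>0. \<forall>z. \<bar>heat_kernel t z\<bar> \<le> C * t powr (- q) * heat_kernel (2 * t) z"
    using heat_kernel_bound by (intro exI[of _ 2] conjI exI[of _ 0]) auto
qed (use heat_kernel_continuous in auto)

lemma gaussian_family_heat_kernel_dx: "gaussian_family heat_kernel_dx"
  unfolding gaussian_family_def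
proof (intro conjI)
  show "(\<lambda>p. heat_kernel_dx (fst p) (snd p)) \<in> borel_measurable borel"
    unfolding heat_kernel_dx_def by (simp flip: borel_prod add: heat_kernel_def)
  show "continuous_on ({0<..} \<times> UNIV) (\<lambda>p. heat_kernel_dx (fst p) (snd p))"
    unfolding heat_kernel_dx_def by (intro continuous_intros heat_kernel_continuous) auto
  show "\<exists>C\<ge>0. \<exists>q\<ge>0. \<forall>t>0. \<forall>z. \<bar>heat_kernel_dx t z\<bar> \<le> C * t powr (- q) * heat_kernel (2 * t) z"
    using heat_kernel_dx_bound by (intro exI[of _ 2] conjI exI[of _ "1/2"]) auto
qed

lemma gaussian_family_heat_kernel_dxx: "gaussian_family heat_kernel_dxx"
  unfolding gaussian_family_def
proof (intro conjI)
  show "(\<lambda>p. heat_kernel_dxx (fst p) (snd p)) \<in> borel_measurable borel"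
    unfolding heat_kernel_dxx_def by (simp flip: borel_prod add: heat_kernel_def)
  show "continuous_on ({0<..} \<times> UNIV) (\<lambda>p. heat_kernel_dxx (fst p) (snd p))"
    unfolding heat_kernel_dxx_def by (intro continuous_intros heat_kernel_continuous) auto
  show "\<exists>C\<ge>0. \<exists>q\<ge>0. \<forall>t>0. \<forall>z. \<bar>heat_kernel_dxx t z\<bar> \<le> C * t powr (- q) * heat_kernel (2 * t) z"
    using heat_kernel_dxx_bound by (intro exI[of _ 5] conjI exI[of _ 1]) auto
qed

text \<open>Limits and derivatives in \<open>s\<close> and \<open>x\<close> need one integrable
  majorant near \<open>(t, x)\<close>. The time \<open>8 t\<close> arises in two doublings:
  \<open>s \<le> 2 * t\<close> leads to the exponent of time \<open>4 t\<close>, and replacing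
  \<open>(x' - y)^2\<close> by \<open>(x - y)^2 / 2 - 1\<close> doubles this once more. The
  \<open>- 1\<close> becomes the factor \<open>exp (1 / (16 * t))\<close>, and \<open>sqrt 8\<close>
  corrects the normalisation.\<close>

lemma heat_kernel_local_bound:
  assumes t: "t > 0" and s: "t / 2 \<le> s" "s \<le> 2 * t" and x: "\<bar>x' - x\<bar> \<le> 1"
  shows "heat_kernel (2 * s) (x' - y)
    \<le> (exp (1 / (16 * t)) * sqrt 8) * heat_kernel (8 * t) (x - y)"
proof -
  have s0: "s > 0" using t s by linarith
  have sq: "(x - y)\<^sup>2 / 2 - 1 \<le> (x' - y)\<^sup>2"
  proof -
    have "(x - y)\<^sup>2 \<le> 2 * (x' - y)\<^sup>2 + 2 * (x' - x)\<^sup>2"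
      using zero_le_power2[of "(x' - y) + (x' - x)"] by (simp add: power2_eq_square algebra_simps)
    moreover have "(x' - x)\<^sup>2 \<le> 1" using x by (simp add: abs_square_le_1)
    ultimately show ?thesis by simp
  qed
  have "- ((x' - y)\<^sup>2) / (4 * (2 * s)) \<le> - ((x' - y)\<^sup>2) / (16 * t)"
    using s s0 t by (simp add: frac_le)
  also have "\<dots> \<le> - ((x - y)\<^sup>2 / 2 - 1) / (16 * t)"
    using sq t by (intro divide_right_mono) auto
  also have "\<dots> = 1 / (16 * t) + - ((x - y)\<^sup>2) / (4 * (8 * t))"
    using t by (simp add: field_simps)
  finally have "exp (- ((x' - y)\<^sup>2) / (4 * (2 * s)))
      \<le> exp (1 / (16 * t)) * exp (- ((x - y)\<^sup>2) / (4 * (8 * t)))"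
    by (simp flip: exp_add)
  moreover have "sqrt (4 * pi * t) \<le> sqrt (4 * pi * (2 * s))" using s t by simp
  ultimately have "heat_kernel (2 * s) (x' - y)
      \<le> (exp (1 / (16 * t)) * exp (- ((x - y)\<^sup>2) / (4 * (8 * t)))) / sqrt (4 * pi * t)"
    unfolding heat_kernel_def using t s0 by (intro frac_le) auto
  also have "\<dots> = (exp (1 / (16 * t)) * sqrt 8) * heat_kernel (8 * t) (x - y)"
  proof -
    have "sqrt (4 * pi * (8 * t)) = sqrt 8 * sqrt (4 * pi * t)"
      using real_sqrt_mult[of 8 "4 * pi * t"] by (simp add: mult_ac)
    then show ?thesis using t by (simp add: heat_kernel_def del: real_sqrt_mult)
  qed
  finally show ?thesis .
qed

lemma gaussian_family_local_bound:
  assumes "gaussian_family K" and t: "t > 0"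
  obtains C where "C \<ge> 0" "\<And>s x x' y. \<lbrakk>t / 2 \<le> s; s \<le> 2 * t; \<bar>x' - x\<bar> \<le> 1\<rbrakk>
    \<Longrightarrow> \<bar>K s (x' - y)\<bar> \<le> C * heat_kernel (8 * t) (x - y)"
proof -
  obtain C q where C: "C \<ge> 0" "q \<ge> 0"
    and b: "\<And>t z. t > 0 \<Longrightarrow> \<bar>K t z\<bar> \<le> C * t powr (- q) * heat_kernel (2 * t) z"
    using assms unfolding gaussian_family_def by metis
  show ?thesis
  proof (rule that)
    show "C * (t / 2) powr (- q) * (exp (1 / (16 * t)) * sqrt 8) \<ge> 0" using C by simp
    fix s x x' y :: real assume s: "t / 2 \<le> s" "s \<le> 2 * t" "\<bar>x' - x\<bar> \<le> 1"
    have s0: "s > 0" using t s by linarith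
    have "s powr (- q) \<le> (t / 2) powr (- q)" using s s0 t C by (intro powr_mono2') auto
    then have "C * s powr (- q) \<le> C * (t / 2) powr (- q)" using C by (intro mult_left_mono) auto
    have "\<bar>K s (x' - y)\<bar> \<le> C * s powr (- q) * heat_kernel (2 * s) (x' - y)" using b s0 by blast
    also have "\<dots> \<le> (C * (t / 2) powr (- q)) * ((exp (1 / (16 * t)) * sqrt 8) * heat_kernel (8 * t) (x - y))"
      using s0 C
      by (intro mult_mono[OF \<open>C * s powr (- q) \<le> C * (t / 2) powr (- q)\<close>
            heat_kernel_local_bound[OF t s]]) auto
    finally show "\<bar>K s (x' - y)\<bar> \<le> C * (t / 2) powr (- q) * (exp (1 / (16 * t)) * sqrt 8) * heat_kernel (8 * t) (x - y)"
      by (simp add: mult_ac)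
  qed
qed

section \<open>Convolution with Gaussian kernels\<close>

lemma gaussian_family_measurable:
  assumes "gaussian_family K"
  shows "K t \<in> borel_measurable borel"
proof -
  have "(\<lambda>p. K (fst p) (snd p)) \<in> borel_measurable borel"
    using assms by (simp add: gaussian_family_def)
  from measurable_compose[OF measurable_Pair1' this[folded borel_prod], of t]
  show ?thesis by simp
qed

lemma integrable_conv:
  assumes K: "gaussian_family K" and t: "t > 0"
    and g: "g \<in> borel_measurable borel" "\<And>y. \<bar>g y\<bar> \<le> B"
  shows "integrable lborel (\<lambda>y. K t (x - y) * g y)"
proof -
  obtain C where C: "C \<ge> 0" "\<And>s x x' y. \<lbrakk>t / 2 \<le> s; s \<le> 2 * t; \<bar>x' - x\<bar> \<le> 1\<rbrakk>
    \<Longrightarrow> \<bar>K s (x' - y)\<bar> \<le> C * heat_kernel (8 * t) (x - y)"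
    using gaussian_family_local_bound[OF K t] by blast
  note [measurable] = gaussian_family_measurable[OF K] g(1)
  show ?thesis
  proof (rule Bochner_Integration.integrable_bound)
    show "integrable lborel (\<lambda>y. C * heat_kernel (8 * t) (x - y) * B)"
      using integrable_reflect_shift[OF integrable_heat_kernel[of "8 * t"]] t by auto
    show "AE y in lborel. norm (K t (x - y) * g y) \<le> norm (C * heat_kernel (8 * t) (x - y) * B)"
    proof (rule AE_I2)
      fix y
      have "norm (K t (x - y) * g y) \<le> C * heat_kernel (8 * t) (x - y) * B"
        unfolding real_norm_def abs_mult using t C(1) by (intro mult_mono C(2) g(2)) auto
      then show "norm (K t (x - y) * g y) \<le> norm (C * heat_kernel (8 * t) (x - y) * B)" by simp
    qed
  qed measurable
qed

text \<open>Dominated convergence with the kernel time, the time of the source and the point varying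
  together; the majorant comes from the kernel, so pointwise continuity of \<open>F\<close> in time
  suffices.\<close>

lemma conv_continuous:
  fixes F :: "real \<Rightarrow> real \<Rightarrow> real"
  assumes K: "gaussian_family K"
    and F: "\<And>s. F s \<in> borel_measurable borel" "\<And>s y. \<bar>F s y\<bar> \<le> B"
      "\<And>y. continuous_on UNIV (\<lambda>s. F s y)"
  shows "continuous_on ({0<..} \<times> UNIV \<times> UNIV) (\<lambda>(t, s, x). conv (K t) (F s) x)"
proof (rule continuous_on_sequentiallyI, clarsimp)
  fix u :: "nat \<Rightarrow> real \<times> real \<times> real" and t s x :: real
  assume u: "\<forall>n. u n \<in> {0<..} \<times> UNIV" and t: "0 < t" and lim: "u \<longlonglongrightarrow> (t, s, x)"
  define a b c where "a n = fst (u n)" and "b n = fst (snd (u n))" and "c n = snd (snd (u n))" for n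
  have abc: "a \<longlonglongrightarrow> t" "b \<longlonglongrightarrow> s" "c \<longlonglongrightarrow> x"
    unfolding a_def b_def c_def using tendsto_fst[OF lim] tendsto_snd[OF lim]
      tendsto_fst[OF tendsto_snd[OF lim]] tendsto_snd[OF tendsto_snd[OF lim]] by simp_all
  obtain C where C: "C \<ge> 0" "\<And>s x x' y. \<lbrakk>t / 2 \<le> s; s \<le> 2 * t; \<bar>x' - x\<bar> \<le> 1\<rbrakk>
    \<Longrightarrow> \<bar>K s (x' - y)\<bar> \<le> C * heat_kernel (8 * t) (x - y)"
    using gaussian_family_local_bound[OF K t] by blast
  have "\<forall>\<^sub>F n in sequentially. t / 2 < a n" "\<forall>\<^sub>F n in sequentially. a n < 2 * t"
    by (rule order_tendstoD[OF abc(1)], use t in simp)+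
  moreover have "\<forall>\<^sub>F n in sequentially. \<bar>c n - x\<bar> < 1"
    using tendstoD[OF abc(3), of 1] by (simp add: dist_real_def)
  ultimately have "\<forall>\<^sub>F n in sequentially. t / 2 \<le> a n \<and> a n \<le> 2 * t \<and> \<bar>c n - x\<bar> \<le> 1"
    by eventually_elim auto
  then obtain N where N: "\<And>n. n \<ge> N \<Longrightarrow> t / 2 \<le> a n \<and> a n \<le> 2 * t \<and> \<bar>c n - x\<bar> \<le> 1"
    by (auto simp: eventually_sequentially)
  note [measurable] = gaussian_family_measurable[OF K] F(1)
  have "(\<lambda>n. LINT y|lborel. K (a (n + N)) (c (n + N) - y) * F (b (n + N)) y)
     \<longlonglongrightarrow> (LINT y|lborel. K t (x - y) * F s y)"
  proof (rule integral_dominated_convergence)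
    show "integrable lborel (\<lambda>y. C * heat_kernel (8 * t) (x - y) * B)"
      using integrable_reflect_shift[OF integrable_heat_kernel[of "8 * t"]] t by auto
    show "AE y in lborel. norm (K (a (n + N)) (c (n + N) - y) * F (b (n + N)) y)
       \<le> C * heat_kernel (8 * t) (x - y) * B" for n
      unfolding real_norm_def abs_mult using t C(1) N[of "n + N"]
      by (intro AE_I2 mult_mono C(2) F(2)) auto
    show "AE y in lborel. (\<lambda>n. K (a (n + N)) (c (n + N) - y) * F (b (n + N)) y)
       \<longlonglongrightarrow> K t (x - y) * F s y"
    proof (intro AE_I2 tendsto_mult)
      fix y
      have "((\<lambda>n. K (fst (a (n + N), c (n + N) - y)) (snd (a (n + N), c (n + N) - y)))
          \<longlongrightarrow> K (fst (t, x - y)) (snd (t, x - y))) sequentially"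
      proof (rule continuous_on_tendsto_compose[where f = "\<lambda>p. K (fst p) (snd p)" and s = "{0<..} \<times> UNIV"])
        show "continuous_on ({0<..} \<times> UNIV) (\<lambda>p. K (fst p) (snd p))"
          using K by (simp add: gaussian_family_def)
        show "(\<lambda>n. (a (n + N), c (n + N) - y)) \<longlonglongrightarrow> (t, x - y)"
          by (intro tendsto_intros LIMSEQ_ignore_initial_segment abc)
      qed (use u t in \<open>auto simp: a_def mem_Times_iff\<close>)
      then show "(\<lambda>n. K (a (n + N)) (c (n + N) - y)) \<longlonglongrightarrow> K t (x - y)" by simp
      show "(\<lambda>n. F (b (n + N)) y) \<longlonglongrightarrow> F s y"
        using F(3)[of y] LIMSEQ_ignore_initial_segment[OF abc(2), of N]
        unfolding continuous_on_sequentially by (auto simp: o_def)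
    qed
  qed measurable
  from LIMSEQ_offset[OF this]
  have "(\<lambda>n. conv (K (a n)) (F (b n)) (c n)) \<longlonglongrightarrow> conv (K t) (F s) x"
    by (simp add: conv_def)
  then show "(\<lambda>n. case u n of (t, s, x) \<Rightarrow> conv (K t) (F s) x) \<longlonglongrightarrow> conv (K t) (F s) x"
    by (simp add: a_def b_def c_def case_prod_beta)
qed

lemma conv_continuous_x:
  assumes K: "gaussian_family K" and t: "t > 0"
    and g: "g \<in> borel_measurable borel" "\<And>y. \<bar>g y\<bar> \<le> B"
  shows "continuous_on UNIV (conv (K t) g)"
proof -
  have "continuous_on ({0<..} \<times> UNIV \<times> UNIV) (\<lambda>(t, s::real, x). conv (K t) g x)"
    by (rule conv_continuous[OF K, of "\<lambda>_. g"]) (use g in auto)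
  from continuous_on_compose2[OF this, of UNIV "\<lambda>x. (t, 0, x)"] show ?thesis
    using t by (simp add: image_subset_iff continuous_intros)
qed

section \<open>Differentiation under the integral sign\<close>

lemma has_real_derivative_integral_dominated:
  fixes P P' :: "real \<Rightarrow> real \<Rightarrow> real"
  assumes d: "d > 0"
    and P: "\<And>p y. \<bar>p - p0\<bar> < d \<Longrightarrow> ((\<lambda>p. P p y) has_real_derivative P' p y) (at p)"
    and bound: "\<And>p y. \<bar>p - p0\<bar> < d \<Longrightarrow> \<bar>P' p y\<bar> \<le> D y" and D: "integrable lborel D"
    and int: "\<And>p. \<bar>p - p0\<bar> < d \<Longrightarrow> integrable lborel (P p)"
    and meas [measurable]: "P' p0 \<in> borel_measurable borel"
  shows "((\<lambda>p. LINT y|lborel. P p y) has_real_derivative (LINT y|lborel. P' p0 y)) (at p0)"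
  unfolding DERIV_def tendsto_at_iff_sequentially
proof (clarsimp simp: o_def)
  fix X :: "nat \<Rightarrow> real"
  assume X0: "\<forall>n. X n \<noteq> 0" and X: "X \<longlonglongrightarrow> 0"
  have "\<forall>\<^sub>F n in sequentially. \<bar>X n\<bar> < d"
    using tendstoD[OF X d] by (simp add: dist_real_def)
  then obtain N where N: "\<And>n. n \<ge> N \<Longrightarrow> \<bar>X n\<bar> < d" by (auto simp: eventually_sequentially)
  have i: "integrable lborel (P (p0 + X (n + N)))" "integrable lborel (P p0)" for n
    using int[of "p0 + X (n + N)"] int[of p0] N[of "n + N"] d by auto
  have "(\<lambda>n. LINT y|lborel. (P (p0 + X (n + N)) y - P p0 y) / X (n + N)) \<longlonglongrightarrow> (LINT y|lborel. P' p0 y)"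
  proof (rule integral_dominated_convergence)
    show "integrable lborel D" by (rule D)
    show "(\<lambda>y. (P (p0 + X (n + N)) y - P p0 y) / X (n + N)) \<in> borel_measurable lborel" for n
      using borel_measurable_integrable[OF i(1)[of n]] borel_measurable_integrable[OF i(2)] by measurable
    show "AE y in lborel. (\<lambda>n. (P (p0 + X (n + N)) y - P p0 y) / X (n + N)) \<longlonglongrightarrow> P' p0 y"
    proof (rule AE_I2)
      fix y
      have "(\<lambda>h. (P (p0 + h) y - P p0 y) / h) \<midarrow>0\<rightarrow> P' p0 y"
        using P[of p0 y] d by (simp add: DERIV_def)
      then show "(\<lambda>n. (P (p0 + X (n + N)) y - P p0 y) / X (n + N)) \<longlonglongrightarrow> P' p0 y"
        unfolding tendsto_at_iff_sequentially o_def
        using X0 LIMSEQ_ignore_initial_segment[OF X, of N] by auto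
    qed
    show "AE y in lborel. norm ((P (p0 + X (n + N)) y - P p0 y) / X (n + N)) \<le> D y" for n
    proof (rule AE_I2)
      fix y
      define h where "h = X (n + N)"
      have h: "h \<noteq> 0" "\<bar>h\<bar> < d" using X0 N[of "n + N"] by (auto simp: h_def)
      \<comment> \<open>The mean value inequality passes the bound on \<open>P'\<close> to the
        difference quotients, uniformly in the increment.\<close>
      have "norm (P (p0 + h) y - P p0 y) \<le> D y * norm (p0 + h - p0)"
      proof (rule field_differentiable_bound[where S = "ball p0 d" and f' = "\<lambda>p. P' p y"])
        show "((\<lambda>p. P p y) has_field_derivative P' p y) (at p within ball p0 d)"
          if "p \<in> ball p0 d" for p
          using P[of p y] that by (auto simp: dist_real_def abs_minus_commute intro: DERIV_subset)
        show "norm (P' p y) \<le> D y" if "p \<in> ball p0 d" for p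
          using bound[of p y] that by (auto simp: dist_real_def abs_minus_commute)
      qed (use h d in \<open>auto simp: dist_real_def\<close>)
      then show "norm ((P (p0 + X (n + N)) y - P p0 y) / X (n + N)) \<le> D y"
        unfolding h_def[symmetric] using h by (simp add: abs_divide pos_divide_le_eq)
    qed
  qed measurable
  then have "(\<lambda>n. ((LINT y|lborel. P (p0 + X (n + N)) y) - (LINT y|lborel. P p0 y)) / X (n + N))
      \<longlonglongrightarrow> (LINT y|lborel. P' p0 y)"
    using i by simp
  from LIMSEQ_offset[OF this]
  show "(\<lambda>n. ((LINT y|lborel. P (p0 + X n) y) - (LINT y|lborel. P p0 y)) / X n)
      \<longlonglongrightarrow> (LINT y|lborel. P' p0 y)" .
qed

lemma conv_has_derivative_x:
  assumes K: "gaussian_family K" "gaussian_family K'" and t: "t > 0"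
    and der: "\<And>z. (K t has_real_derivative K' t z) (at z)"
    and g: "g \<in> borel_measurable borel" "\<And>y. \<bar>g y\<bar> \<le> B"
  shows "(conv (K t) g has_real_derivative conv (K' t) g x) (at x)"
proof -
  obtain C where C: "C \<ge> 0" "\<And>s x x' y. \<lbrakk>t / 2 \<le> s; s \<le> 2 * t; \<bar>x' - x\<bar> \<le> 1\<rbrakk>
    \<Longrightarrow> \<bar>K' s (x' - y)\<bar> \<le> C * heat_kernel (8 * t) (x - y)"
    using gaussian_family_local_bound[OF K(2) t] by blast
  note [measurable] = gaussian_family_measurable[OF K(2)] g(1)
  show ?thesis
    unfolding conv_def
  proof (rule has_real_derivative_integral_dominated[where d = 1])
    show "integrable lborel (\<lambda>y. C * heat_kernel (8 * t) (x - y) * B)"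
      using integrable_reflect_shift[OF integrable_heat_kernel[of "8 * t"]] t by auto
    show "\<bar>K' t (p - y) * g y\<bar> \<le> C * heat_kernel (8 * t) (x - y) * B" if "\<bar>p - x\<bar> < 1" for p y
      unfolding abs_mult using t C(1) that by (intro mult_mono C(2) g(2)) auto
    show "((\<lambda>p. K t (p - y) * g y) has_real_derivative K' t (p - y) * g y) (at p)" for p y
      by (intro DERIV_cmult_right DERIV_chain2[OF der, where Db = 1, THEN DERIV_cong])
         (auto intro!: derivative_eq_intros)
    show "integrable lborel (\<lambda>y. K t (p - y) * g y)" for p
      by (rule integrable_conv[OF K(1) t g])
  qed (use t in auto)
qed

lemma conv_has_derivative_t:
  assumes t: "t > 0" and g: "g \<in> borel_measurable borel" "\<And>y. \<bar>g y\<bar> \<le> B"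
  shows "((\<lambda>t. conv (heat_kernel t) g x) has_real_derivative conv (heat_kernel_dxx t) g x) (at t)"
proof -
  obtain C where C: "C \<ge> 0" "\<And>s x x' y. \<lbrakk>t / 2 \<le> s; s \<le> 2 * t; \<bar>x' - x\<bar> \<le> 1\<rbrakk>
    \<Longrightarrow> \<bar>heat_kernel_dxx s (x' - y)\<bar> \<le> C * heat_kernel (8 * t) (x - y)"
    using gaussian_family_local_bound[OF gaussian_family_heat_kernel_dxx t] by blast
  note [measurable] = gaussian_family_measurable[OF gaussian_family_heat_kernel_dxx] g(1)
  have p: "p > 0" "t / 2 \<le> p" "p \<le> 2 * t" if "\<bar>p - t\<bar> < t / 2" for p
    using that t by (simp_all only: abs_less_iff, linarith+)
  show ?thesis
    unfolding conv_def
  proof (rule has_real_derivative_integral_dominated[where d = "t / 2"])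
    show "integrable lborel (\<lambda>y. C * heat_kernel (8 * t) (x - y) * B)"
      using integrable_reflect_shift[OF integrable_heat_kernel[of "8 * t"]] t by auto
    show "\<bar>heat_kernel_dxx p (x - y) * g y\<bar> \<le> C * heat_kernel (8 * t) (x - y) * B"
      if "\<bar>p - t\<bar> < t / 2" for p y
      unfolding abs_mult using t C(1) p[OF that] by (intro mult_mono C(2) g(2)) auto
    show "((\<lambda>p. heat_kernel p (x - y) * g y) has_real_derivative heat_kernel_dxx p (x - y) * g y) (at p)"
      if "\<bar>p - t\<bar> < t / 2" for p y
      using p[OF that] by (intro DERIV_cmult_right heat_kernel_has_derivative_t)
    show "integrable lborel (\<lambda>y. heat_kernel p (x - y) * g y)" if "\<bar>p - t\<bar> < t / 2" for p
      by (rule integrable_conv[OF gaussian_family_heat_kernel p(1)[OF that] g])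
  qed (use t in auto)
qed

lemma heat_conv_has_derivative_x:
  assumes "t > 0" "g \<in> borel_measurable borel" "\<And>y. \<bar>g y\<bar> \<le> B"
  shows "(conv (heat_kernel t) g has_real_derivative conv (heat_kernel_dx t) g x) (at x)"
    and "(conv (heat_kernel_dx t) g has_real_derivative conv (heat_kernel_dxx t) g x) (at x)"
  using assms
  by (auto intro!: conv_has_derivative_x gaussian_family_heat_kernel gaussian_family_heat_kernel_dx
      gaussian_family_heat_kernel_dxx heat_kernel_has_derivative_x heat_kernel_dx_has_derivative_x)

text \<open>The time \<open>s\<close> of the majorant is not tied to that of \<open>K\<close>,
  because derivative kernels are bounded at doubled time. The function \<open>r\<close> may be
  unbounded, as the exponential weights are, so its integrability against the kernel is
  assumed.\<close>

lemma conv_abs_le: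
  assumes "s > 0" "c \<ge> 0" and K: "\<And>z. \<bar>K z\<bar> \<le> c * heat_kernel s z"
    and g: "\<And>y. \<bar>g y\<bar> \<le> r y" and r: "integrable lborel (\<lambda>y. heat_kernel s (x - y) * r y)"
  shows "\<bar>conv K g x\<bar> \<le> c * conv (heat_kernel s) r x"
proof -
  have r0: "r y \<ge> 0" for y using g[of y] by linarith
  have "\<bar>LINT y|lborel. K (x - y) * g y\<bar> \<le> (LINT y|lborel. \<bar>K (x - y) * g y\<bar>)"
    by (rule integral_abs_bound)
  also have "\<dots> \<le> (LINT y|lborel. c * (heat_kernel s (x - y) * r y))"
  proof (rule integral_mono')
    fix y
    show "\<bar>K (x - y) * g y\<bar> \<le> c * (heat_kernel s (x - y) * r y)"
      unfolding abs_mult mult.assoc[symmetric] using assms(1,2) by (intro mult_mono K g) auto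
  qed (use assms(1,2) r r0 in auto)
  finally show ?thesis by (simp add: conv_def)
qed

lemma conv_const: "conv K (\<lambda>_. b) x = b * (LINT z|lborel. K z)"
  unfolding conv_def using integral_reflect_shift[of "\<lambda>z. K z * b" x] by simp

lemma heat_conv_const: "t > 0 \<Longrightarrow> conv (heat_kernel t) (\<lambda>_. b) x = b"
  by (simp add: conv_const integral_heat_kernel)

lemma heat_dx_conv_const:
  assumes "t > 0"
  shows "conv (heat_kernel_dx t) (\<lambda>_. b) x = 0"
proof -
  have "(conv (heat_kernel t) (\<lambda>_. b) has_real_derivative conv (heat_kernel_dx t) (\<lambda>_. b) x) (at x)"
    by (rule heat_conv_has_derivative_x(1)[where B = "\<bar>b\<bar>"]) (use assms in auto)
  moreover have "conv (heat_kernel t) (\<lambda>_. b) = (\<lambda>_. b)"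
    using heat_conv_const[OF assms] by auto
  ultimately show ?thesis using DERIV_unique DERIV_const by metis
qed

lemma conv_abs_le_const:
  assumes "s > 0" "c \<ge> 0" "\<And>z. \<bar>K z\<bar> \<le> c * heat_kernel s z" "\<And>y. \<bar>g y\<bar> \<le> B"
  shows "\<bar>conv K g x\<bar> \<le> c * B"
proof -
  have "integrable lborel (\<lambda>y. heat_kernel s (x - y) * B)"
    by (rule integrable_conv[OF gaussian_family_heat_kernel, where B = "\<bar>B\<bar>"]) (use assms in auto)
  from conv_abs_le[OF assms this] show ?thesis using assms by (simp add: heat_conv_const)
qed

lemma heat_dx_conv_abs_le:
  assumes "t > 0" "\<And>y. \<bar>g y\<bar> \<le> B"
  shows "\<bar>conv (heat_kernel_dx t) g x\<bar> \<le> 2 * t powr (- (1/2)) * B"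
  by (rule conv_abs_le_const[of "2 * t"]) (use assms heat_kernel_dx_bound in auto)

lemma heat_conv_abs_le:
  assumes "t > 0" "\<And>y. \<bar>g y\<bar> \<le> B"
  shows "\<bar>conv (heat_kernel t) g x\<bar> \<le> B"
  using conv_abs_le_const[of t 1 "heat_kernel t" g B x] assms by simp

lemma heat_conv_mono:
  assumes t: "t > 0" and "\<And>y. g y \<le> h y"
    and g: "g \<in> borel_measurable borel" "\<And>y. \<bar>g y\<bar> \<le> B"
    and h: "h \<in> borel_measurable borel" "\<And>y. \<bar>h y\<bar> \<le> B"
  shows "conv (heat_kernel t) g x \<le> conv (heat_kernel t) h x"
  unfolding conv_def
  by (rule integral_mono) (use assms in \<open>auto intro!: mult_left_mono integrable_conv[OF gaussian_family_heat_kernel]\<close>)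

lemma conv_diff:
  assumes K: "gaussian_family K" and t: "t > 0"
    and g: "g \<in> borel_measurable borel" "\<And>y. \<bar>g y\<bar> \<le> B"
    and h: "h \<in> borel_measurable borel" "\<And>y. \<bar>h y\<bar> \<le> B'"
  shows "conv (K t) (\<lambda>y. g y - h y) x = conv (K t) g x - conv (K t) h x"
  unfolding conv_def right_diff_distrib
  by (rule Bochner_Integration.integral_diff; rule integrable_conv[OF K t]) (use g h in auto)

text \<open>Chebyshev's argument: for \<open>\<bar>z\<bar> \<ge> d\<close> the factor
  \<open>z^2 / d^2\<close> is at least 1, and the second moment of the kernel is
  \<open>2 * t\<close>. Apart from the local modulus \<open>e\<close> the bound does not see
  \<open>x\<close>, so an equicontinuous bounded family converges uniformly.\<close>

lemma heat_conv_error: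
  assumes t: "t > 0" and d: "d > 0" and g: "g \<in> borel_measurable borel" "\<And>y. \<bar>g y\<bar> \<le> B"
    and e: "e \<ge> 0" "\<And>y. \<bar>y - x\<bar> < d \<Longrightarrow> \<bar>g y - g x\<bar> \<le> e"
  shows "\<bar>conv (heat_kernel t) g x - g x\<bar> \<le> e + 2 * B / d\<^sup>2 * (2 * t)"
proof -
  note [measurable] = g(1)
  have B: "B \<ge> 0" using g(2)[of 0] by linarith
  have i: "integrable lborel (\<lambda>z. e * heat_kernel t z + 2 * B / d\<^sup>2 * (heat_kernel t z * z\<^sup>2))"
    using integrable_heat_kernel[OF t] second_moment_heat_kernel[OF t]
    by (intro Bochner_Integration.integrable_add integrable_mult_right) (auto simp: has_bochner_integral_iff)
  have "conv (heat_kernel t) g x - g x = conv (heat_kernel t) (\<lambda>y. g y - g x) x"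
    by (subst conv_diff[OF gaussian_family_heat_kernel t g, of _ "\<bar>g x\<bar>"])
       (auto simp: heat_conv_const[OF t])
  also have "\<bar>\<dots>\<bar> \<le> (LINT z|lborel. \<bar>heat_kernel t z * (g (x - z) - g x)\<bar>)"
    unfolding conv_flip by (rule integral_abs_bound)
  also have "\<dots> \<le> (LINT z|lborel. e * heat_kernel t z + 2 * B / d\<^sup>2 * (heat_kernel t z * z\<^sup>2))"
  proof (rule integral_mono'[OF i])
    fix z
    have "\<bar>g (x - z) - g x\<bar> \<le> e + 2 * B / d\<^sup>2 * z\<^sup>2"
    proof (cases "\<bar>z\<bar> < d")
      case True
      then have "\<bar>g (x - z) - g x\<bar> \<le> e" by (intro e) auto
      moreover have "2 * B / d\<^sup>2 * z\<^sup>2 \<ge> 0" using B by simp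
      ultimately show ?thesis by linarith
    next
      case False
      then have "d\<^sup>2 \<le> z\<^sup>2" using d abs_le_square_iff[of d z] by simp
      then have "1 \<le> z\<^sup>2 / d\<^sup>2" using d by simp
      then have "2 * B * 1 \<le> 2 * B * (z\<^sup>2 / d\<^sup>2)" using B by (intro mult_left_mono) auto
      moreover have "\<bar>g (x - z) - g x\<bar> \<le> 2 * B" using g(2)[of "x - z"] g(2)[of x] by linarith
      ultimately show ?thesis using e(1) by simp
    qed
    from mult_left_mono[OF this heat_kernel_nonneg[of t z]] t
    show "\<bar>heat_kernel t z * (g (x - z) - g x)\<bar>
        \<le> e * heat_kernel t z + 2 * B / d\<^sup>2 * (heat_kernel t z * z\<^sup>2)"
      unfolding abs_mult by (simp add: distrib_left mult_ac)
    show "0 \<le> e * heat_kernel t z + 2 * B / d\<^sup>2 * (heat_kernel t z * z\<^sup>2)"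
      using t B e(1) by simp
  qed
  also have "\<dots> = e + 2 * B / d\<^sup>2 * (2 * t)"
    using integrable_heat_kernel[OF t] second_moment_heat_kernel[OF t] integral_heat_kernel[OF t]
    by (subst Bochner_Integration.integral_add) (auto simp: has_bochner_integral_iff)
  finally show ?thesis .
qed

section \<open>Exponential weights and the semigroup law\<close>

lemma heat_kernel_exp_shift:
  assumes "t > 0"
  shows "heat_kernel t z * exp (k * z) = exp (k\<^sup>2 * t) * heat_kernel t (2 * k * t - z)"
proof -
  have "- (z\<^sup>2) / (4 * t) + k * z = k\<^sup>2 * t + - ((2 * k * t - z)\<^sup>2) / (4 * t)"
    using assms by (simp add: field_simps power2_eq_square)
  then show ?thesis by (simp add: heat_kernel_def flip: exp_add)
qed

text \<open>Completing the square shows that exponentials are eigenfunctions of the heat flow. This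
  makes exponential weights the natural measure of the behaviour at infinity.\<close>

lemma heat_conv_exp:
  assumes "t > 0"
  shows "integrable lborel (\<lambda>y. heat_kernel t (x - y) * exp (- k * y))"
    and "conv (heat_kernel t) (\<lambda>y. exp (- k * y)) x = exp (k\<^sup>2 * t) * exp (- k * x)"
proof -
  have e: "heat_kernel t (x - y) * exp (- k * y)
      = exp (- k * x) * exp (k\<^sup>2 * t) * heat_kernel t ((2 * k * t - x) - (- y))" for y
  proof -
    have "exp (- k * y) = exp (- k * x) * exp (k * (x - y))"
      by (simp flip: exp_add add: algebra_simps)
    then show ?thesis using heat_kernel_exp_shift[OF assms, of "x - y" k] by (simp add: algebra_simps)
  qed
  have i: "has_bochner_integral lborel (\<lambda>y. heat_kernel t ((2 * k * t - x) - (- y))) 1"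
    using lborel_has_bochner_integral_real_affine_iff[of 1 "heat_kernel t" 1 "2 * k * t - x"]
      integrable_heat_kernel[OF assms] integral_heat_kernel[OF assms]
    by (simp add: has_bochner_integral_iff)
  show "integrable lborel (\<lambda>y. heat_kernel t (x - y) * exp (- k * y))"
    unfolding e using i by (auto simp: has_bochner_integral_iff)
  show "conv (heat_kernel t) (\<lambda>y. exp (- k * y)) x = exp (k\<^sup>2 * t) * exp (- k * x)"
    unfolding conv_def e using i by (auto simp: has_bochner_integral_iff)
qed

text \<open>The sum of independent centred normal variables with variances \<open>2 * s\<close> and
  \<open>2 * t\<close> has variance \<open>2 * (s + t)\<close>; the variable \<open>z\<close> is a
  translation.\<close>

lemma heat_kernel_semigroup:
  assumes "s > 0" "t > 0"
  shows "has_bochner_integral lborel (\<lambda>y. heat_kernel s (x - y) * heat_kernel t (y - z)) (heat_kernel (s + t) (x - z))"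
proof -
  have "(\<integral>\<^sup>+y. ennreal (heat_kernel s ((x - z) - y) * heat_kernel t y) \<partial>lborel) = ennreal (heat_kernel (s + t) (x - z))"
    using fun_cong[OF conv_normal_density_zero_mean[of "sqrt (2 * s)" "sqrt (2 * t)"], of "x - z"] assms
    by (simp add: heat_kernel_eq_normal_density)
  then have "has_bochner_integral lborel (\<lambda>y. heat_kernel s ((x - z) - y) * heat_kernel t y) (heat_kernel (s + t) (x - z))"
    using assms gaussian_family_measurable[OF gaussian_family_heat_kernel]
    by (intro has_bochner_integral_nn_integral) auto
  then show ?thesis
    using lborel_has_bochner_integral_real_affine_iff[of 1 "\<lambda>y. heat_kernel s ((x - z) - y) * heat_kernel t y" "heat_kernel (s + t) (x - z)" "- z"]
    by simp
qed

lemma heat_conv_semigroup: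
  assumes s: "s > 0" and t: "t > 0" and g: "g \<in> borel_measurable borel" "\<And>y. \<bar>g y\<bar> \<le> B"
  shows "conv (heat_kernel s) (conv (heat_kernel t) g) x = conv (heat_kernel (s + t)) g x"
proof -
  note [measurable] = gaussian_family_measurable[OF gaussian_family_heat_kernel] g(1)
  have B: "B \<ge> 0" using g(2)[of 0] by linarith
  have "integrable (lborel \<Otimes>\<^sub>M lborel) (\<lambda>(z, y). heat_kernel s (x - y) * heat_kernel t (y - z) * g z)"
  proof (rule lborel_pair.Fubini_integrable)
    show "AE z in lborel. integrable lborel (\<lambda>y. case (z, y) of (z, y) \<Rightarrow> heat_kernel s (x - y) * heat_kernel t (y - z) * g z)"
      using heat_kernel_semigroup[OF s t] by (intro AE_I2) (auto simp: has_bochner_integral_iff)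
    have "(LINT y|lborel. norm (heat_kernel s (x - y) * heat_kernel t (y - z) * g z)) = heat_kernel (s + t) (x - z) * \<bar>g z\<bar>" for z
      using heat_kernel_semigroup[OF s t, of x z] s t by (simp add: abs_mult has_bochner_integral_iff)
    moreover have "integrable lborel (\<lambda>z. heat_kernel (s + t) (x - z) * \<bar>g z\<bar>)"
      by (rule integrable_conv[OF gaussian_family_heat_kernel, where B = B]) (use s t g in auto)
    ultimately show "integrable lborel (\<lambda>z. LINT y|lborel. norm (case (z, y) of (z, y) \<Rightarrow> heat_kernel s (x - y) * heat_kernel t (y - z) * g z))"
      by simp
  qed measurable
  from lborel_pair.Fubini_integral[OF this]
  have "(LINT y|lborel. LINT z|lborel. heat_kernel s (x - y) * heat_kernel t (y - z) * g z)
      = (LINT z|lborel. LINT y|lborel. heat_kernel s (x - y) * heat_kernel t (y - z) * g z)" .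
  also have "\<dots> = (LINT z|lborel. heat_kernel (s + t) (x - z) * g z)"
    using heat_kernel_semigroup[OF s t] by (simp add: has_bochner_integral_iff)
  finally show ?thesis by (simp add: conv_def mult.assoc)
qed

text \<open>Obtained by differentiating the semigroup law for \<open>heat_kernel\<close> in
  \<open>x\<close>. On the left the derivative falls on the inner convolution, whose derivative is
  bounded for \<open>t > 0\<close>.\<close>

lemma heat_dx_conv_semigroup:
  assumes s: "s > 0" and t: "t > 0" and g: "g \<in> borel_measurable borel" "\<And>y. \<bar>g y\<bar> \<le> B"
  shows "conv (heat_kernel s) (conv (heat_kernel_dx t) g) x = conv (heat_kernel_dx (s + t)) g x"
proof -
  define p p' where "p = conv (heat_kernel t) g" and "p' = conv (heat_kernel_dx t) g"
  have der: "(p has_real_derivative p' x) (at x)" for x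
    unfolding p_def p'_def by (rule heat_conv_has_derivative_x[OF t g])
  define C where "C = 2 * t powr (- (1/2)) * B"
  have C: "\<bar>p' x\<bar> \<le> C" for x
    unfolding p'_def C_def by (rule heat_dx_conv_abs_le[OF t g(2)])
  have pB: "\<bar>p x\<bar> \<le> B" for x unfolding p_def by (rule heat_conv_abs_le[OF t g(2)])
  have [measurable]: "p \<in> borel_measurable borel" "p' \<in> borel_measurable borel"
    unfolding p_def p'_def
    by (intro borel_measurable_continuous_onI conv_continuous_x[OF _ t g]
        gaussian_family_heat_kernel gaussian_family_heat_kernel_dx)+
  note [measurable] = gaussian_family_measurable[OF gaussian_family_heat_kernel]
  have int: "integrable lborel (\<lambda>z. heat_kernel s z * p (x - z))" for x
    using integrable_reflect_shift[OF integrable_conv[OF gaussian_family_heat_kernel s, of p B x], of x] pB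
    by simp
  have "((\<lambda>x. LINT z|lborel. heat_kernel s z * p (x - z)) has_real_derivative
      (LINT z|lborel. heat_kernel s z * p' (x - z))) (at x)"
  proof (rule has_real_derivative_integral_dominated[where d = 1])
    show "integrable lborel (\<lambda>z. heat_kernel s z * C)" using integrable_heat_kernel[OF s] by simp
    show "\<bar>heat_kernel s z * p' (q - z)\<bar> \<le> heat_kernel s z * C" for q z
      using s C[of "q - z"] by (simp add: abs_mult mult_left_mono)
    show "((\<lambda>q. heat_kernel s z * p (q - z)) has_real_derivative heat_kernel s z * p' (q - z)) (at q)" for q z
      by (intro DERIV_cmult DERIV_chain2[OF der, where Db = 1, THEN DERIV_cong])
         (auto intro!: derivative_eq_intros)
  qed (use int in auto)
  then have "(conv (heat_kernel s) p has_real_derivative conv (heat_kernel s) p' x) (at x)"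
    by (simp add: conv_flip[abs_def])
  moreover have "conv (heat_kernel s) p = conv (heat_kernel (s + t)) g"
    unfolding p_def by (rule ext) (rule heat_conv_semigroup[OF s t g])
  moreover have "(conv (heat_kernel (s + t)) g has_real_derivative conv (heat_kernel_dx (s + t)) g x) (at x)"
    by (rule heat_conv_has_derivative_x) (use s t g in auto)
  ultimately show ?thesis unfolding p'_def by (metis DERIV_unique)
qed

section \<open>Mild solutions on a bounded time interval\<close>

text \<open>Division by zero gives zero, so the Duhamel integrand has a harmless value at its
  endpoint \<open>s = t\<close>.\<close>

lemma heat_kernel_dx_0 [simp]: "heat_kernel_dx 0 z = 0"
  by (simp add: heat_kernel_dx_def)

lemma heat_dx_conv_abs_le':
  assumes "t \<ge> 0" "\<And>y. \<bar>g y\<bar> \<le> B"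
  shows "\<bar>conv (heat_kernel_dx t) g x\<bar> \<le> 2 * t powr (- (1/2)) * B"
proof (cases "t = 0")
  case True
  then show ?thesis by (simp add: conv_def)
next
  case False
  then show ?thesis using heat_dx_conv_abs_le[of t g B x] assms by simp
qed

text \<open>The case \<open>a = - 1/2\<close> makes the Duhamel integrand absolutely integrable;
  \<open>a = - 3/4\<close> serves the weighted estimate, where exponential decay is traded for a
  further power \<open>- 1/4\<close>.\<close>

lemma has_bochner_integral_powr_diff:
  fixes a t :: real
  assumes a: "a > -1" and t: "t \<ge> 0"
  shows "has_bochner_integral lborel (\<lambda>s. indicator {0..t} s * (t - s) powr a) (t powr (a + 1) / (a + 1))"
proof -
  have "(\<integral>\<^sup>+ s. ennreal (indicator {0..t} s * s powr a) \<partial>lborel) = ennreal (t powr (a + 1) / (a + 1))"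
    using nn_integral_has_integral_lebesgue[OF _ has_integral_powr_from_0[OF a t]]
    by simp
  then have "has_bochner_integral lborel (\<lambda>s. indicator {0..t} s * s powr a) (t powr (a + 1) / (a + 1))"
    using a by (intro has_bochner_integral_nn_integral) (auto intro!: divide_nonneg_pos)
  moreover have "indicator {0..t} (t - s) = (indicator {0..t} s :: real)" for s
    by (auto simp: indicator_def)
  ultimately show ?thesis
    using lborel_has_bochner_integral_real_affine_iff[of "-1" "\<lambda>s. indicator {0..t} s * s powr a" _ t]
    by simp
qed

text \<open>The curve is controlled for all real times, so that continuity statements need no
  one-sided versions, while the equation is imposed only on \<open>(0,T]\<close>. A global solution
  fits in by freezing time outside \<open>[0,T]\<close>, which also provides a single bound
  \<open>M\<close> and a single Lipschitz constant \<open>L\<close>.\<close>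

locale mild_flow =
  fixes f :: "real \<Rightarrow> real" and U :: "real \<Rightarrow> real \<Rightarrow> real" and T M L :: real
  assumes T_pos: "T > 0"
    and U_curve: "\<And>s0 e. e > 0 \<Longrightarrow> \<exists>d>0. \<forall>s. \<bar>s - s0\<bar> < d \<longrightarrow> (\<forall>x. \<bar>U s x - U s0 x\<bar> \<le> e)"
    and U_unif_cont: "\<And>s. uniformly_continuous_on UNIV (U s)"
    and U_bound: "\<And>s x. \<bar>U s x\<bar> \<le> M"
    and f_lipschitz: "L-lipschitz_on {-M..M} f"
    and mild: "\<And>t x. 0 < t \<Longrightarrow> t \<le> T \<Longrightarrow> U t x = conv (heat_kernel t) (U 0) x +
        (LBINT s:{0..t}. conv (heat_kernel_dx (t - s)) (\<lambda>y. f (U s y)) x)"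
begin

abbreviation F :: "real \<Rightarrow> real \<Rightarrow> real" where
  "F s y \<equiv> f (U s y)"

lemma M_nonneg: "M \<ge> 0"
  using U_bound[of 0 0] by linarith

lemma L_nonneg: "L \<ge> 0"
  using f_lipschitz by (rule lipschitz_on_nonneg)

lemma U_mem: "U s x \<in> {-M..M}"
  using U_bound[of s x] by (simp add: abs_le_iff)

lemma f_diff_le: "a \<in> {-M..M} \<Longrightarrow> b \<in> {-M..M} \<Longrightarrow> \<bar>f a - f b\<bar> \<le> L * \<bar>a - b\<bar>"
  using lipschitz_onD[OF f_lipschitz] by (simp add: dist_real_def)

definition B :: real where "B = \<bar>f 0\<bar> + L * M"

lemma B_nonneg: "B \<ge> 0"
  unfolding B_def using L_nonneg M_nonneg by simp

lemma F_bound: "\<bar>F s x\<bar> \<le> B"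
proof -
  have "\<bar>F s x - f 0\<bar> \<le> L * \<bar>U s x - 0\<bar>" using M_nonneg by (intro f_diff_le U_mem) auto
  also have "\<dots> \<le> L * M" using L_nonneg U_bound[of s x] by (intro mult_left_mono) auto
  finally show ?thesis unfolding B_def by linarith
qed

lemma U_continuous: "continuous_on UNIV (\<lambda>p. U (fst p) (snd p))"
proof (clarsimp simp: continuous_on_iff)
  fix s0 x0 e :: real assume e: "e > 0"
  obtain d1 where d1: "d1 > 0" "\<And>s x. \<bar>s - s0\<bar> < d1 \<Longrightarrow> \<bar>U s x - U s0 x\<bar> \<le> e / 3"
    using U_curve[of "e / 3" s0] e by auto
  obtain d2 where d2: "d2 > 0" "\<And>x. dist x x0 < d2 \<Longrightarrow> dist (U s0 x) (U s0 x0) < e / 3"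
    using U_unif_cont[of s0] e unfolding uniformly_continuous_on_def
    by (metis UNIV_I dist_commute divide_pos_pos zero_less_numeral)
  show "\<exists>d>0. \<forall>a b. dist (a, b) (s0, x0) < d \<longrightarrow> dist (U a b) (U s0 x0) < e"
  proof (intro exI[of _ "min d1 d2"] conjI allI impI)
    fix a b assume "dist (a, b) (s0, x0) < min d1 d2"
    then have "dist a s0 < d1" "dist b x0 < d2"
      using dist_fst_le[of "(a, b)" "(s0, x0)"] dist_snd_le[of "(a, b)" "(s0, x0)"] by auto
    then have "\<bar>U a b - U s0 b\<bar> \<le> e / 3" "dist (U s0 b) (U s0 x0) < e / 3"
      using d1 d2 by (auto simp: dist_real_def)
    then show "dist (U a b) (U s0 x0) < e" using e unfolding dist_real_def by linarith
  qed (use d1 d2 in auto)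
qed

lemma F_continuous: "continuous_on UNIV (\<lambda>p. F (fst p) (snd p))"
  by (rule continuous_on_compose2[OF lipschitz_on_continuous_on[OF f_lipschitz] U_continuous])
     (use U_mem in auto)

lemma U_measurable [measurable]: "U s \<in> borel_measurable borel"
  using U_unif_cont uniformly_continuous_imp_continuous
  by (blast intro: borel_measurable_continuous_onI)

lemma U_continuous_s: "continuous_on UNIV (\<lambda>s. U s y)"
  using continuous_on_compose2[OF U_continuous, of UNIV "\<lambda>s. (s, y)"] by (simp add: continuous_intros)

lemma F_continuous_s: "continuous_on UNIV (\<lambda>s. F s y)"
  using continuous_on_compose2[OF F_continuous, of UNIV "\<lambda>s. (s, y)"] by (simp add: continuous_intros)

lemma F_measurable [measurable]: "F s \<in> borel_measurable borel"
  using continuous_on_compose2[OF F_continuous, of UNIV "\<lambda>x. (s, x)"]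
  by (intro borel_measurable_continuous_onI) (simp add: continuous_intros)

lemma Duhamel_measurable:
  "(\<lambda>(s, y). conv (heat_kernel_dx (t - s)) (F s) y) \<in> borel_measurable (lborel \<Otimes>\<^sub>M lborel)"
proof -
  have 1: "(\<lambda>w. F (fst (fst w)) (snd w)) \<in> borel_measurable ((lborel \<Otimes>\<^sub>M lborel) \<Otimes>\<^sub>M lborel)"
    by (rule measurable_compose[OF _ borel_measurable_continuous_onI[OF F_continuous],
          of "\<lambda>w. (fst (fst w), snd w)", simplified]) (simp flip: borel_prod)
  have "(\<lambda>p. heat_kernel_dx (fst p) (snd p)) \<in> borel_measurable borel"
    using gaussian_family_heat_kernel_dx by (simp add: gaussian_family_def)
  from measurable_compose[OF _ this, of "\<lambda>w. (t - fst (fst w), snd (fst w) - snd w)", simplified]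
  have 2: "(\<lambda>w. heat_kernel_dx (t - fst (fst w)) (snd (fst w) - snd w)) \<in> borel_measurable ((lborel \<Otimes>\<^sub>M lborel) \<Otimes>\<^sub>M lborel)"
    by (simp flip: borel_prod)
  have "(\<lambda>w. LINT z|lborel. heat_kernel_dx (t - fst w) (snd w - z) * F (fst w) z)
      \<in> borel_measurable (lborel \<Otimes>\<^sub>M lborel)"
    by (rule lborel.borel_measurable_lebesgue_integral)
       (use borel_measurable_times[OF 2 1] in \<open>simp add: case_prod_beta\<close>)
  then show ?thesis by (simp add: conv_def case_prod_beta)
qed

text \<open>The semigroup property moves the singularity of the Duhamel integrand from \<open>s = t\<close> to \<open>s = t + e\<close>.\<close>

lemma mollified_mild:
  assumes t: "0 \<le> t" "t \<le> T" and e: "e > 0"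
  shows "conv (heat_kernel e) (U t) x = conv (heat_kernel (e + t)) (U 0) x +
        (LBINT s:{0..t}. conv (heat_kernel_dx (e + t - s)) (F s) x)"
proof (cases "t = 0")
  case True
  have "(LBINT s:{0..0}. conv (heat_kernel_dx (e - s)) (F s) x) = 0"
    unfolding set_lebesgue_integral_def
  proof (rule integral_eq_zero_AE)
    show "AE s in lborel. indicat_real {0..0} s *\<^sub>R conv (heat_kernel_dx (e - s)) (F s) x = 0"
      using AE_lborel_singleton[of 0] by eventually_elim (simp add: indicator_def)
  qed
  then show ?thesis using True by simp
next
  case False
  then have t0: "t > 0" using t by simp
  define A where "A = conv (heat_kernel t) (U 0)"
  define h where "h s y = conv (heat_kernel_dx (t - s)) (F s) y" for s y
  have A: "A \<in> borel_measurable borel" "\<bar>A y\<bar> \<le> M" for y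
    unfolding A_def
    by (auto intro!: heat_conv_abs_le[OF t0] U_bound borel_measurable_continuous_onI
        conv_continuous_x[OF gaussian_family_heat_kernel t0 U_measurable U_bound])
  have h_meas [measurable]: "(\<lambda>(s, y). h s y) \<in> borel_measurable (lborel \<Otimes>\<^sub>M lborel)"
    unfolding h_def by (rule Duhamel_measurable)
  have h_bound: "\<bar>h s y\<bar> \<le> 2 * (t - s) powr (- (1/2)) * B" if "s \<in> {0..t}" for s y
    unfolding h_def using that by (intro heat_dx_conv_abs_le' F_bound) auto
  have h_cont: "h s \<in> borel_measurable borel" for s
    using measurable_compose[OF measurable_Pair1' h_meas, of s] by simp
  note [measurable] = gaussian_family_measurable[OF gaussian_family_heat_kernel]
  have "conv (heat_kernel e) (U t) x - conv (heat_kernel e) A x = conv (heat_kernel e) (\<lambda>y. U t y - A y) x"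
    by (rule conv_diff[symmetric, OF gaussian_family_heat_kernel e U_measurable U_bound A])
  also have "(\<lambda>y. U t y - A y) = (\<lambda>y. LINT s|lborel. indicator {0..t} s * h s y)"
    using mild[OF t0 t(2)] by (auto simp: A_def h_def set_lebesgue_integral_def)
  also have "conv (heat_kernel e) \<dots> x
      = (LINT y|lborel. LINT s|lborel. indicator {0..t} s * (heat_kernel e (x - y) * h s y))"
    by (simp add: conv_def mult.left_commute flip: integral_mult_right_zero)
  \<comment> \<open>Fubini applies because the inner integral of the absolute value is at most a
    multiple of \<open>(t - s) powr (- (1/2))\<close>.\<close>
  also have "\<dots> = (LINT s|lborel. LINT y|lborel. indicator {0..t} s * (heat_kernel e (x - y) * h s y))"
  proof (rule lborel_pair.Fubini_integral, rule lborel_pair.Fubini_integrable)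
    show "(\<lambda>(s, y). indicat_real {0..t} s * (heat_kernel e (x - y) * h s y)) \<in> borel_measurable (lborel \<Otimes>\<^sub>M lborel)"
      using h_meas by measurable
    then have m: "(\<lambda>s. LINT y|lborel. norm (indicat_real {0..t} s * (heat_kernel e (x - y) * h s y))) \<in> borel_measurable lborel"
      by measurable
    have le: "indicat_real {0..t} s * \<bar>h s y\<bar> \<le> 2 * B * (indicat_real {0..t} s * (t - s) powr (- (1/2)))" for s y
      using h_bound[of s y] by (auto simp: indicator_def mult_ac)
    show "AE s in lborel. integrable lborel (\<lambda>y. case (s, y) of (s, y) \<Rightarrow> indicat_real {0..t} s * (heat_kernel e (x - y) * h s y))"
    proof (rule AE_I2)
      fix s
      show "integrable lborel (\<lambda>y. case (s, y) of (s, y) \<Rightarrow> indicat_real {0..t} s * (heat_kernel e (x - y) * h s y))"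
        using h_bound[of s]
        by (auto simp: indicator_def intro!: integrable_conv[OF gaussian_family_heat_kernel e h_cont])
    qed
    show "integrable lborel (\<lambda>s. LINT y|lborel. norm (case (s, y) of (s, y) \<Rightarrow> indicat_real {0..t} s * (heat_kernel e (x - y) * h s y)))"
    proof (rule Bochner_Integration.integrable_bound)
      show "integrable lborel (\<lambda>s. 2 * B * (indicator {0..t} s * (t - s) powr (- (1/2))))"
        using has_bochner_integral_powr_diff[of "- (1/2)" t] t by (auto simp: has_bochner_integral_iff)
      show "AE s in lborel. norm (LINT y|lborel. norm (case (s, y) of (s, y) \<Rightarrow> indicat_real {0..t} s * (heat_kernel e (x - y) * h s y)))
          \<le> norm (2 * B * (indicator {0..t} s * (t - s) powr (- (1/2))))"
      proof (rule AE_I2)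
        fix s
        have "(LINT y|lborel. norm (indicat_real {0..t} s * (heat_kernel e (x - y) * h s y)))
            = conv (heat_kernel e) (\<lambda>y. indicat_real {0..t} s * \<bar>h s y\<bar>) x"
          using e by (simp add: conv_def abs_mult mult.left_commute)
        moreover have "\<bar>\<dots>\<bar> \<le> 2 * B * (indicat_real {0..t} s * (t - s) powr (- (1/2)))"
          by (rule heat_conv_abs_le[OF e]) (use le in auto)
        ultimately show "norm (LINT y|lborel. norm (case (s, y) of (s, y) \<Rightarrow> indicat_real {0..t} s * (heat_kernel e (x - y) * h s y)))
          \<le> norm (2 * B * (indicator {0..t} s * (t - s) powr (- (1/2))))"
          by simp
      qed
    qed (use m in simp)
  qed
  also have "\<dots> = (LINT s|lborel. indicator {0..t} s * conv (heat_kernel e) (h s) x)"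
    by (simp add: conv_def)
  also have "\<dots> = (LINT s|lborel. indicator {0..t} s * conv (heat_kernel_dx (e + t - s)) (F s) x)"
  proof (rule integral_cong_AE)
    show "(\<lambda>s. indicat_real {0..t} s * conv (heat_kernel e) (h s) x) \<in> borel_measurable lborel"
      unfolding conv_def using h_meas by measurable
    show "(\<lambda>s. indicat_real {0..t} s * conv (heat_kernel_dx (e + t - s)) (F s) x) \<in> borel_measurable lborel"
      using measurable_compose[OF measurable_Pair2' Duhamel_measurable, of x "e + t"] by simp
    \<comment> \<open>The semigroup law requires \<open>t - s > 0\<close>; the excluded point
      \<open>s = t\<close> is a null set.\<close>
    show "AE s in lborel. indicat_real {0..t} s * conv (heat_kernel e) (h s) x
        = indicat_real {0..t} s * conv (heat_kernel_dx (e + t - s)) (F s) x"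
      using AE_lborel_singleton[of t]
    proof eventually_elim
      case (elim s)
      show ?case
      proof (cases "s \<in> {0..t}")
        case True
        then have "t - s > 0" using elim by simp
        from heat_dx_conv_semigroup[OF e this F_measurable F_bound]
        show ?thesis unfolding h_def by (simp add: algebra_simps)
      qed simp
    qed
  qed
  finally have "conv (heat_kernel e) (U t) x - conv (heat_kernel e) A x
      = (LBINT s:{0..t}. conv (heat_kernel_dx (e + t - s)) (F s) x)"
    by (simp add: set_lebesgue_integral_def)
  moreover have "conv (heat_kernel e) A x = conv (heat_kernel (e + t)) (U 0) x"
    unfolding A_def by (rule heat_conv_semigroup[OF e t0 U_measurable U_bound])
  ultimately show ?thesis by simp
qed

end

lemma continuous_on_conv:
  fixes F :: "real \<Rightarrow> real \<Rightarrow> real"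
  assumes "gaussian_family K"
    and "\<And>s. F s \<in> borel_measurable borel" "\<And>s y. \<bar>F s y\<bar> \<le> B"
      "\<And>y. continuous_on UNIV (\<lambda>s. F s y)"
    and "continuous_on S a" "continuous_on S b" "continuous_on S c" and "\<And>p. p \<in> S \<Longrightarrow> a p > 0"
  shows "continuous_on S (\<lambda>p. conv (K (a p)) (F (b p)) (c p))"
proof -
  have "continuous_on S (\<lambda>p. (a p, b p, c p))" using assms by (intro continuous_intros)
  moreover have "(\<lambda>p. (a p, b p, c p)) ` S \<subseteq> {0<..} \<times> UNIV \<times> UNIV" using assms by auto
  ultimately show ?thesis
    using continuous_on_compose2[OF conv_continuous[OF assms(1-4)], of S "\<lambda>p. (a p, b p, c p)"] by simp
qed

context mild_flow
begin

section \<open>Regularity of the mollified solution\<close>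

lemmas continuous_on_conv_U = continuous_on_conv[OF _ U_measurable U_bound U_continuous_s]
lemmas continuous_on_conv_F = continuous_on_conv[OF _ F_measurable F_bound F_continuous_s]

lemma conv_F_continuous_time:
  assumes "t < r"
  shows "continuous_on {..t} (\<lambda>s. conv (heat_kernel_dx (r - s)) (F s) x)"
  by (rule continuous_on_conv_F) (use assms in \<open>auto intro!: continuous_intros gaussian_family_heat_kernel_dx\<close>)

text \<open>Mollifying at time \<open>r - t\<close> with \<open>r\<close> fixed leaves
  \<open>t\<close> only in the limit of integration, so the fundamental theorem of calculus applies
  in \<open>t\<close>. As \<open>t < r\<close>, the integrand is continuous on \<open>{0..t}\<close>
  and the two notions of integral agree.\<close>

lemma mollified_mild_integral:
  assumes t: "0 \<le> t" "t \<le> T" and r: "t < r"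
  shows "conv (heat_kernel (r - t)) (U t) x = conv (heat_kernel r) (U 0) x +
        integral {0..t} (\<lambda>s. conv (heat_kernel_dx (r - s)) (F s) x)"
proof -
  have "continuous_on {0..t} (\<lambda>s. conv (heat_kernel_dx (r - s)) (F s) x)"
    using conv_F_continuous_time[OF r] by (rule continuous_on_subset) auto
  from borel_integrable_atLeastAtMost'[OF this]
  have "(LBINT s:{0..t}. conv (heat_kernel_dx (r - s)) (F s) x)
      = integral {0..t} (\<lambda>s. conv (heat_kernel_dx (r - s)) (F s) x)"
    by (rule set_borel_integral_eq_integral(2))
  with mollified_mild[OF t, of "r - t" x] r show ?thesis by simp
qed

text \<open>For \<open>\<tau> < \<sigma>\<close> the function \<open>J \<sigma> \<tau>\<close> below has two descriptions. Duhamel's formula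
  shows its \<open>\<tau>\<close>-derivative, and \<open>J \<sigma> \<tau> = conv (heat_kernel (\<sigma> - \<tau>)) (U \<tau>)\<close> its \<open>\<sigma>\<close>-derivative;
  the mollified solution is the restriction of \<open>J\<close> to \<open>\<sigma> = \<tau> + e\<close>.\<close>

lemma mollified_has_derivative_t:
  assumes t: "0 < t" "t < T" and e: "e > 0"
  shows "((\<lambda>t. conv (heat_kernel e) (U t) x) has_real_derivative
      conv (heat_kernel_dxx e) (U t) x + conv (heat_kernel_dx e) (F t) x) (at t)"
proof -
  define J where "J \<sigma> \<tau> = conv (heat_kernel \<sigma>) (U 0) x +
        integral {0..\<tau>} (\<lambda>s. conv (heat_kernel_dx (\<sigma> - s)) (F s) x)" for \<sigma> \<tau>
  have J: "J \<sigma> \<tau> = conv (heat_kernel (\<sigma> - \<tau>)) (U \<tau>) x" if "0 \<le> \<tau>" "\<tau> \<le> T" "\<tau> < \<sigma>" for \<sigma> \<tau>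
    using mollified_mild_integral[OF that] by (simp add: J_def)
  \<comment> \<open>The half-widths \<open>e/4\<close> keep \<open>\<sigma> - \<tau>\<close> above
    \<open>e/2\<close> on \<open>X \<times> Y\<close>, away from the singularity of the
    kernel.\<close>
  define X where "X = {0<..<T} \<inter> {t - e/4<..<t + e/4}"
  define Y where "Y = {t + e - e/4<..<t + e + e/4}"
  have XY: "0 < \<tau>" "\<tau> < T" "\<tau> < \<sigma>" if "\<tau> \<in> X" "\<sigma> \<in> Y" for \<tau> \<sigma>
    using that e by (auto simp: X_def Y_def)
  have tX: "t \<in> X" "t + e \<in> Y" using t e by (auto simp: X_def Y_def)
  have op: "open (X \<times> Y)" unfolding X_def Y_def by (intro open_Times open_Int open_greaterThanLessThan)
  define c where "c \<tau> \<sigma> = conv (heat_kernel_dxx (\<sigma> - \<tau>)) (U \<tau>) x" for \<tau> \<sigma>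
  \<comment> \<open>Total differentiability follows from a \<open>\<tau>\<close>-derivative at the
    single point and a \<open>\<sigma>\<close>-derivative that exists nearby and is jointly
    continuous. The integral formula for \<open>J\<close> gives the former, the convolution formula
    the latter.\<close>
  have "((\<lambda>(\<tau>, \<sigma>). J \<sigma> \<tau>) has_derivative
      (\<lambda>(a, b). conv (heat_kernel_dx e) (F t) x * a + blinfun_mult_right (c t (t + e)) b)) (at (t, t + e) within X \<times> Y)"
  proof (rule has_derivative_partialsI)
    have cont: "continuous_on {0..t + e/2} (\<lambda>s. conv (heat_kernel_dx (t + e - s)) (F s) x)"
      by (rule continuous_on_subset[OF conv_F_continuous_time]) (use e in auto)
    have "((\<lambda>\<tau>. integral {0..\<tau>} (\<lambda>s. conv (heat_kernel_dx (t + e - s)) (F s) x)) has_real_derivative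
       conv (heat_kernel_dx (t + e - t)) (F t) x) (at t within {0..t + e/2})"
      by (rule integral_has_real_derivative[OF cont]) (use t e in auto)
    moreover have "at t within {0..t + e/2} = at t"
      by (rule at_within_interior) (use t e in auto)
    ultimately have "((\<lambda>\<tau>. J (t + e) \<tau>) has_real_derivative conv (heat_kernel_dx e) (F t) x) (at t)"
      unfolding J_def by (auto intro!: derivative_eq_intros)
    then show "((\<lambda>\<tau>. J (t + e) \<tau>) has_derivative (\<lambda>a. conv (heat_kernel_dx e) (F t) x * a)) (at t within X)"
      by (simp add: has_field_derivative_def has_derivative_at_withinI)
    show "((\<lambda>\<sigma>. J \<sigma> \<tau>) has_derivative blinfun_apply (blinfun_mult_right (c \<tau> \<sigma>))) (at \<sigma> within Y)"
      if "\<tau> \<in> X" "\<sigma> \<in> Y" for \<tau> \<sigma>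
    proof -
      have "((\<lambda>\<sigma>. conv (heat_kernel (\<sigma> - \<tau>)) (U \<tau>) x) has_real_derivative c \<tau> \<sigma>) (at \<sigma>)"
        unfolding c_def
        by (rule DERIV_chain2[OF conv_has_derivative_t[OF _ U_measurable U_bound], where Db = 1, THEN DERIV_cong])
           (use XY[OF that] in \<open>auto intro!: derivative_eq_intros\<close>)
      then have "((\<lambda>\<sigma>. conv (heat_kernel (\<sigma> - \<tau>)) (U \<tau>) x) has_derivative (\<lambda>b. c \<tau> \<sigma> * b)) (at \<sigma> within Y)"
        by (simp add: has_field_derivative_def has_derivative_at_withinI)
      then have "((\<lambda>\<sigma>. J \<sigma> \<tau>) has_derivative (\<lambda>b. c \<tau> \<sigma> * b)) (at \<sigma> within Y)"
        by (rule has_derivative_transform_within[OF _ zero_less_one that(2)])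
           (use J XY[OF that(1)] in \<open>auto simp: less_imp_le\<close>)
      then show ?thesis by simp
    qed
    have "continuous_on (X \<times> Y) (\<lambda>p. conv (heat_kernel_dxx (snd p - fst p)) (U (fst p)) x)"
      by (rule continuous_on_conv_U) (use XY in \<open>auto intro!: continuous_intros gaussian_family_heat_kernel_dxx\<close>)
    then have "continuous_on (X \<times> Y) (\<lambda>(\<tau>, \<sigma>). blinfun_mult_right (c \<tau> \<sigma>))"
      unfolding c_def case_prod_beta
      by (rule bounded_linear.continuous_on[OF bounded_linear_blinfun_mult_right])
    then show "continuous (at (t, t + e) within X \<times> Y) (\<lambda>(\<tau>, \<sigma>). blinfun_mult_right (c \<tau> \<sigma>))"
      using tX by (simp add: continuous_on_eq_continuous_within)
    show "convex Y" unfolding Y_def by simp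
  qed (rule tX)
  then have D: "((\<lambda>(\<tau>, \<sigma>). J \<sigma> \<tau>) has_derivative
      (\<lambda>(a, b). conv (heat_kernel_dx e) (F t) x * a + c t (t + e) * b)) (at (t, t + e))"
    using at_within_open[OF _ op, of "(t, t + e)"] tX by (simp add: case_prod_beta)
  have "((\<lambda>\<tau>. (\<tau>, \<tau> + e)) has_derivative (\<lambda>h. (h, h))) (at t)"
    by (auto intro!: derivative_eq_intros)
  from has_derivative_compose[OF this D]
  have "((\<lambda>\<tau>. J (\<tau> + e) \<tau>) has_derivative
      (\<lambda>h. conv (heat_kernel_dx e) (F t) x * h + c t (t + e) * h)) (at t)"
    by simp
  moreover have "(\<lambda>h. conv (heat_kernel_dx e) (F t) x * h + c t (t + e) * h)
      = (*) (conv (heat_kernel_dxx e) (U t) x + conv (heat_kernel_dx e) (F t) x)"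
    by (auto simp: fun_eq_iff c_def algebra_simps)
  ultimately have "((\<lambda>\<tau>. J (\<tau> + e) \<tau>) has_real_derivative
      conv (heat_kernel_dxx e) (U t) x + conv (heat_kernel_dx e) (F t) x) (at t)"
    by (simp add: has_field_derivative_def)
  then show ?thesis
    by (rule has_field_derivative_transform_within_open[where S = "{0<..<T}"]) (use t e J in auto)
qed

text \<open>Compactness of \<open>[0,T]\<close>: the curve is continuous in the sup-norm, so the
  modulus of continuity of \<open>U t\<close> also serves nearby times, and finitely many times
  suffice.\<close>

lemma U_equicontinuous:
  assumes "e > 0"
  obtains d where "d > 0" "\<And>t x y. \<lbrakk>0 \<le> t; t \<le> T; \<bar>y - x\<bar> < d\<rbrakk> \<Longrightarrow> \<bar>U t y - U t x\<bar> \<le> e"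
proof -
  have "\<exists>d>0. \<forall>s x y. \<bar>s - t\<bar> < d \<longrightarrow> \<bar>y - x\<bar> < d \<longrightarrow> \<bar>U s y - U s x\<bar> \<le> e" for t
  proof -
    obtain d1 where d1: "d1 > 0" "\<And>s x. \<bar>s - t\<bar> < d1 \<Longrightarrow> \<bar>U s x - U t x\<bar> \<le> e / 3"
      using U_curve[of "e / 3" t] assms by auto
    obtain d2 where d2: "d2 > 0" "\<And>x y. dist y x < d2 \<Longrightarrow> dist (U t y) (U t x) < e / 3"
      using U_unif_cont[of t] assms unfolding uniformly_continuous_on_def
      by (metis UNIV_I divide_pos_pos zero_less_numeral)
    show ?thesis
    proof (intro exI[of _ "min d1 d2"] conjI allI impI)
      fix s x y assume "\<bar>s - t\<bar> < min d1 d2" "\<bar>y - x\<bar> < min d1 d2"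
      then have "\<bar>U s x - U t x\<bar> \<le> e / 3" "\<bar>U s y - U t y\<bar> \<le> e / 3" "\<bar>U t y - U t x\<bar> < e / 3"
        using d1 d2 by (auto simp: dist_real_def)
      then show "\<bar>U s y - U s x\<bar> \<le> e" by linarith
    qed (use d1 d2 in auto)
  qed
  then obtain d where d: "\<And>t. d t > 0"
    "\<And>t s x y. \<bar>s - t\<bar> < d t \<Longrightarrow> \<bar>y - x\<bar> < d t \<Longrightarrow> \<bar>U s y - U s x\<bar> \<le> e"
    by metis
  obtain N where N: "finite N" "N \<subseteq> {0..T}" "{0..T} \<subseteq> (\<Union>t\<in>N. ball t (d t))"
    using compactE_image[of "{0..T}" "{0..T}" "\<lambda>t. ball t (d t)"] d(1) by force
  have N0: "N \<noteq> {}" using N(3) T_pos by auto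
  show ?thesis
  proof (rule that)
    show "Min (d ` N) > 0" using N N0 d(1) by simp
    fix t x y assume t: "0 \<le> t" "t \<le> T" and "\<bar>y - x\<bar> < Min (d ` N)"
    obtain r where "r \<in> N" "t \<in> ball r (d r)" using N(3) t by force
    moreover have "Min (d ` N) \<le> d r" using N(1) \<open>r \<in> N\<close> by simp
    ultimately show "\<bar>U t y - U t x\<bar> \<le> e"
      using \<open>\<bar>y - x\<bar> < Min (d ` N)\<close> by (intro d(2)[of t r]) (auto simp: dist_real_def abs_minus_commute)
  qed
qed

text \<open>The second estimate is the price of mollifying a nonlinear equation: a Lipschitz flux
  commutes with mollification up to the common modulus of continuity.\<close>

lemma mollified_uniform:
  assumes e: "e > 0"
  obtains r0 where "r0 > 0"
    "\<And>r t x. \<lbrakk>0 < r; r < r0; 0 \<le> t; t \<le> T\<rbrakk> \<Longrightarrow> \<bar>conv (heat_kernel r) (U t) x - U t x\<bar> \<le> e"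
    "\<And>r t x. \<lbrakk>0 < r; r < r0; 0 \<le> t; t \<le> T\<rbrakk> \<Longrightarrow>
       \<bar>conv (heat_kernel r) (F t) x - f (conv (heat_kernel r) (U t) x)\<bar> \<le> e"
proof -
  \<comment> \<open>The flux error adds up to \<open>(3 * L + 1) * e1\<close>: a part
    \<open>(L + 1) * e1\<close> from mollifying \<open>F\<close> and \<open>2 * L * e1\<close> from
    mollifying \<open>U\<close> inside \<open>f\<close>.\<close>
  define e1 where "e1 = e / (4 * (L + 1))"
  have L: "L + 1 > 0" using L_nonneg by linarith
  have e1: "e1 > 0" "4 * (L + 1) * e1 = e" using e L by (auto simp: e1_def)
  obtain d where d: "d > 0" "\<And>t x y. \<lbrakk>0 \<le> t; t \<le> T; \<bar>y - x\<bar> < d\<rbrakk> \<Longrightarrow> \<bar>U t y - U t x\<bar> \<le> e1"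
    using U_equicontinuous[OF e1(1)] by blast
  \<comment> \<open>Chosen so that \<open>c * r\<close> dominates the second-moment term of
    \<open>heat_conv_error\<close> for both \<open>U\<close> and \<open>F\<close>.\<close>
  define c where "c = 4 * (M + B + 1) / d\<^sup>2"
  have c: "c > 0" using d M_nonneg B_nonneg by (simp add: c_def)
  define r0 where "r0 = e1 / c"
  have 1: "\<bar>conv (heat_kernel r) (U t) x - U t x\<bar> \<le> 2 * e1"
    if "0 < r" "r < r0" "0 \<le> t" "t \<le> T" for r t x
  proof -
    have "\<bar>conv (heat_kernel r) (U t) x - U t x\<bar> \<le> e1 + 2 * M / d\<^sup>2 * (2 * r)"
      using e1 d that by (intro heat_conv_error U_bound U_measurable) auto
    also have "2 * M / d\<^sup>2 * (2 * r) \<le> c * r"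
      using that M_nonneg B_nonneg d unfolding c_def by (simp add: divide_right_mono mult_right_mono)
    also have "c * r \<le> e1" using that c by (simp add: r0_def field_simps)
    finally show ?thesis by simp
  qed
  have 2: "\<bar>conv (heat_kernel r) (F t) x - F t x\<bar> \<le> L * e1 + e1"
    if "0 < r" "r < r0" "0 \<le> t" "t \<le> T" for r t x
  proof -
    have "\<bar>F t y - F t x\<bar> \<le> L * e1" if "\<bar>y - x\<bar> < d" for y
    proof -
      have "\<bar>F t y - F t x\<bar> \<le> L * \<bar>U t y - U t x\<bar>" by (intro f_diff_le U_mem)
      also have "\<dots> \<le> L * e1" using L_nonneg d(2)[of t y x] that \<open>0 \<le> t\<close> \<open>t \<le> T\<close> by (intro mult_left_mono)
      finally show ?thesis .
    qed
    then have "\<bar>conv (heat_kernel r) (F t) x - F t x\<bar> \<le> L * e1 + 2 * B / d\<^sup>2 * (2 * r)"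
      using e1 d that L_nonneg by (intro heat_conv_error F_bound F_measurable) auto
    also have "2 * B / d\<^sup>2 * (2 * r) \<le> c * r"
      using that M_nonneg B_nonneg d unfolding c_def by (simp add: divide_right_mono mult_right_mono)
    also have "c * r \<le> e1" using that c by (simp add: r0_def field_simps)
    finally show ?thesis by simp
  qed
  have Le1: "L * e1 \<ge> 0" using L_nonneg e1 by simp
  have e: "e = 4 * (L * e1) + 4 * e1" using e1(2) by (simp add: algebra_simps)
  show ?thesis
  proof (rule that)
    show "r0 > 0" using e1 c by (simp add: r0_def)
    fix r t x assume *: "0 < r" "r < r0" "0 \<le> t" "t \<le> T"
    show "\<bar>conv (heat_kernel r) (U t) x - U t x\<bar> \<le> e" using 1[OF *, of x] Le1 e e1(1) by linarith
    have "\<bar>conv (heat_kernel r) (U t) x\<bar> \<le> M" by (rule heat_conv_abs_le[OF *(1) U_bound])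
    then have "conv (heat_kernel r) (U t) x \<in> {-M..M}" by (simp add: abs_le_iff)
    then have "\<bar>F t x - f (conv (heat_kernel r) (U t) x)\<bar> \<le> L * \<bar>U t x - conv (heat_kernel r) (U t) x\<bar>"
      by (intro f_diff_le U_mem)
    also have "\<dots> \<le> L * (2 * e1)"
      using 1[OF *, of x] L_nonneg by (intro mult_left_mono) (auto simp: abs_minus_commute)
    finally show "\<bar>conv (heat_kernel r) (F t) x - f (conv (heat_kernel r) (U t) x)\<bar> \<le> e"
      using 2[OF *, of x] Le1 e e1(1) by linarith
  qed
qed

end

section \<open>Persistence of spatial limits\<close>

lemma heat_conv_weight:
  assumes "t > 0"
  shows "integrable lborel (\<lambda>y. heat_kernel t (x - y) * (c * (d + A * exp (- k * y))))"
    and "conv (heat_kernel t) (\<lambda>y. c * (d + A * exp (- k * y))) x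
      = c * (d + A * (exp (k\<^sup>2 * t) * exp (- k * x)))"
proof -
  have e: "heat_kernel t (x - y) * (c * (d + A * exp (- k * y)))
      = c * d * heat_kernel t (x - y) + c * A * (heat_kernel t (x - y) * exp (- k * y))" for y
    by (simp add: algebra_simps)
  have i: "integrable lborel (\<lambda>y. c * d * heat_kernel t (x - y))"
    "integrable lborel (\<lambda>y. c * A * (heat_kernel t (x - y) * exp (- k * y)))"
    using integrable_reflect_shift[OF integrable_heat_kernel[OF assms]] heat_conv_exp(1)[OF assms]
    by auto
  show "integrable lborel (\<lambda>y. heat_kernel t (x - y) * (c * (d + A * exp (- k * y))))"
    unfolding e using i by (rule Bochner_Integration.integrable_add)
  have "conv (heat_kernel t) (\<lambda>y. c * (d + A * exp (- k * y))) x
      = c * d * (LINT y|lborel. heat_kernel t (x - y)) + c * A * conv (heat_kernel t) (\<lambda>y. exp (- k * y)) x"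
    unfolding conv_def e using i by (subst Bochner_Integration.integral_add) auto
  then show "conv (heat_kernel t) (\<lambda>y. c * (d + A * exp (- k * y))) x
      = c * (d + A * (exp (k\<^sup>2 * t) * exp (- k * x)))"
    unfolding heat_conv_exp(2)[OF assms] using integral_heat_kernel[OF assms]
    by (simp add: integral_reflect_shift algebra_simps)
qed

text \<open>Gives up exponential decay for a negative power: the rate \<open>l\<close> then
  contributes a small factor \<open>l powr (- (1/4))\<close>, at the cost of
  \<open>r powr (- (1/4))\<close>, which remains integrable next to
  \<open>r powr (- (1/2))\<close>.\<close>

lemma exp_minus_le_powr:
  fixes y :: real
  assumes "y > 0"
  shows "exp (- y) \<le> y powr (- (1/4))"
proof -
  have "ln y \<le> y - 1" using assms by (rule ln_le_minus_one)
  then have "- y \<le> - (1/4) * ln y" using assms by simp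
  then show ?thesis using assms by (simp add: powr_def)
qed

context mild_flow
begin

definition weighted_bound :: "real \<Rightarrow> real \<Rightarrow> (real \<Rightarrow> real) \<Rightarrow> real \<Rightarrow> bool" where
  "weighted_bound \<phi> l \<rho> N \<longleftrightarrow> N \<ge> 0 \<and>
     (\<forall>t x. 0 \<le> t \<longrightarrow> t \<le> T \<longrightarrow> \<bar>U t x - \<phi>\<bar> \<le> N * exp (l * t) * \<rho> x)"

text \<open>One Picard step in the weighted sup norm; the factor \<open>exp (l * t)\<close> makes it a contraction.\<close>

lemma weighted_bound_step:
  assumes phi: "\<phi> \<in> {-M..M}" and k: "k\<^sup>2 = 1" and d: "d > 0" and A: "A \<ge> 0"
    and rho: "\<rho> = (\<lambda>x. d + A * exp (- k * x))"
    and init: "\<And>x. \<bar>U 0 x - \<phi>\<bar> \<le> \<rho> x"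
    and l: "l = Q ^ 4" and Q: "Q = 16 * (L + 1) * exp (2 * T) * T powr (1/4)"
    and N: "weighted_bound \<phi> l \<rho> N"
  shows "weighted_bound \<phi> l \<rho> (exp T + N / 2)"
proof -
  have L: "L \<ge> 0" by (rule L_nonneg)
  have Q0: "Q > 0" using L T_pos by (simp add: Q)
  have l0: "l > 0" using Q0 by (simp add: l)
  have rho0: "\<rho> x > 0" for x using d A by (simp add: rho add_pos_nonneg)
  have N0: "N \<ge> 0" using N by (simp add: weighted_bound_def)
  have NB: "\<bar>U s y - \<phi>\<bar> \<le> N * exp (l * s) * \<rho> y" if "0 \<le> s" "s \<le> T" for s y
    using N that by (simp add: weighted_bound_def)
  \<comment> \<open>Since \<open>k^2 = 1\<close>, the heat flow multiplies the weight by at most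
    \<open>exp R\<close>.\<close>
  have grow: "d + A * (exp (k\<^sup>2 * r) * exp (- k * x)) \<le> exp R * \<rho> x" if "0 \<le> r" "r \<le> R" for r R x
  proof -
    have "1 \<le> exp R" "exp (k\<^sup>2 * r) \<le> exp R" using that k by auto
    then have "1 * d \<le> exp R * d" "exp (k\<^sup>2 * r) * (A * exp (- k * x)) \<le> exp R * (A * exp (- k * x))"
      using d A by (auto intro!: mult_right_mono)
    then show ?thesis by (simp add: rho algebra_simps)
  qed
  have "\<bar>U t x - \<phi>\<bar> \<le> (exp T + N / 2) * exp (l * t) * \<rho> x" if t: "0 \<le> t" "t \<le> T" for t x
  proof (cases "t = 0")
    case True
    have "exp T \<ge> 1" using T_pos by simp
    then have "1 * \<rho> x \<le> (exp T + N / 2) * \<rho> x"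
      using N0 rho0[of x] by (intro mult_right_mono) linarith+
    with init[of x] True show ?thesis by simp
  next
    case False
    then have t0: "t > 0" using t by simp
    have lt: "exp (l * t) \<ge> 1" using l0 t by simp
    define D where "D = (LBINT s:{0..t}. conv (heat_kernel_dx (t - s)) (F s) x)"
    define C where "C = 2 * L * N * exp (2 * T) * \<rho> x * exp (l * t) / Q"
    have C0: "C \<ge> 0" using L N0 rho0[of x] Q0 by (simp add: C_def)
    have Dx: "\<bar>conv (heat_kernel_dx (t - s)) (F s) x\<bar> \<le> C * (t - s) powr (- (3/4))"
      if s: "0 \<le> s" "s \<le> t" for s
    proof (cases "s = t")
      case True
      then show ?thesis by (simp add: conv_def)
    next
      case False
      define r where "r = t - s"
      have r: "r > 0" "r \<le> T" using False s t by (auto simp: r_def)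
      \<comment> \<open>The derivative kernel annihilates constants, so the flux may be replaced by
        its deviation from \<open>f \<phi>\<close>, which the weight controls.\<close>
      have "conv (heat_kernel_dx r) (\<lambda>y. F s y - f \<phi>) x = conv (heat_kernel_dx r) (F s) x"
        by (subst conv_diff[OF gaussian_family_heat_kernel_dx r(1) F_measurable F_bound, of _ "\<bar>f \<phi>\<bar>"])
           (auto simp: heat_dx_conv_const[OF r(1)])
      then have "\<bar>conv (heat_kernel_dx r) (F s) x\<bar> = \<bar>conv (heat_kernel_dx r) (\<lambda>y. F s y - f \<phi>) x\<bar>"
        by simp
      also have "\<dots> \<le> 2 * r powr (- (1/2)) * conv (heat_kernel (2 * r)) (\<lambda>y. (L * (N * exp (l * s))) * \<rho> y) x"
      proof (rule conv_abs_le)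
        fix y
        have "\<bar>F s y - f \<phi>\<bar> \<le> L * \<bar>U s y - \<phi>\<bar>" using phi by (intro f_diff_le U_mem)
        also have "\<dots> \<le> L * (N * exp (l * s) * \<rho> y)"
          using L s t by (intro mult_left_mono NB) auto
        finally show "\<bar>F s y - f \<phi>\<bar> \<le> (L * (N * exp (l * s))) * \<rho> y" by (simp add: mult_ac)
      next
        show "integrable lborel (\<lambda>y. heat_kernel (2 * r) (x - y) * ((L * (N * exp (l * s))) * \<rho> y))"
          unfolding rho by (rule heat_conv_weight) (use r in auto)
      qed (use r heat_kernel_dx_bound in auto)
      also have "conv (heat_kernel (2 * r)) (\<lambda>y. (L * (N * exp (l * s))) * \<rho> y) x
          = (L * (N * exp (l * s))) * (d + A * (exp (k\<^sup>2 * (2 * r)) * exp (- k * x)))"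
        unfolding rho by (rule heat_conv_weight) (use r in auto)
      also have "2 * r powr (- (1/2)) * \<dots> \<le> 2 * r powr (- (1/2)) * ((L * (N * exp (l * s))) * (exp (2 * T) * \<rho> x))"
        using L N0 r by (intro mult_left_mono grow) auto
      also have "\<dots> = 2 * L * N * exp (2 * T) * \<rho> x * exp (l * t) * (exp (- (l * r)) * r powr (- (1/2)))"
      proof -
        have "exp (l * s) = exp (l * t) * exp (- (l * r))"
          by (simp add: r_def flip: exp_add) (simp add: algebra_simps)
        then show ?thesis by simp
      qed
      also have "\<dots> \<le> 2 * L * N * exp (2 * T) * \<rho> x * exp (l * t) * ((1 / Q) * r powr (- (3/4)))"
      proof (rule mult_left_mono)
        have "exp (- (l * r)) \<le> (l * r) powr (- (1/4))" using l0 r by (intro exp_minus_le_powr) auto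
        also have "\<dots> = l powr (- (1/4)) * r powr (- (1/4))" using l0 r by (simp add: powr_mult)
        also have "l powr (- (1/4)) = 1 / Q"
        proof -
          have "l = Q powr 4" unfolding l using Q0 powr_realpow[of Q 4] by simp
          then have "l powr (- (1/4)) = Q powr (4 * - (1/4))" by (simp only: powr_powr)
          then have "l powr (- (1/4)) = Q powr (- 1)" by simp
          then show ?thesis using Q0 by (simp add: powr_minus_divide)
        qed
        finally have "exp (- (l * r)) * r powr (- (1/2)) \<le> (1 / Q * r powr (- (1/4))) * r powr (- (1/2))"
          by (intro mult_right_mono) auto
        also have "\<dots> = (1 / Q) * r powr (- (3/4))" by (simp flip: powr_add)
        finally show "exp (- (l * r)) * r powr (- (1/2)) \<le> (1 / Q) * r powr (- (3/4))" .
      qed (use L N0 rho0[of x] in auto)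
      also have "\<dots> = C * r powr (- (3/4))" by (simp add: C_def)
      finally show ?thesis by (simp add: r_def)
    qed
    have hb: "has_bochner_integral lborel (\<lambda>s. indicator {0..t} s * (t - s) powr (- (3/4))) (4 * t powr (1/4))"
      using has_bochner_integral_powr_diff[of "- (3/4)" t] t by (simp add: mult.commute)
    have "\<bar>D\<bar> \<le> (LINT s|lborel. \<bar>indicat_real {0..t} s *\<^sub>R conv (heat_kernel_dx (t - s)) (F s) x\<bar>)"
      unfolding D_def set_lebesgue_integral_def by (rule integral_abs_bound)
    also have "\<dots> \<le> (LINT s|lborel. C * (indicator {0..t} s * (t - s) powr (- (3/4))))"
    proof (rule integral_mono')
      show "integrable lborel (\<lambda>s. C * (indicator {0..t} s * (t - s) powr (- (3/4))))"
        using hb by (auto simp: has_bochner_integral_iff)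
    qed (use Dx C0 in \<open>auto simp: indicator_def\<close>)
    also have "\<dots> = C * (4 * t powr (1/4))" using hb by (simp add: has_bochner_integral_iff)
    also have "\<dots> \<le> C * (4 * T powr (1/4))"
      using C0 t by (intro mult_left_mono powr_mono2) auto
    also have "\<dots> = (8 * L * exp (2 * T) * T powr (1/4)) / Q * (N * \<rho> x * exp (l * t))"
      by (simp add: C_def)
    also have "\<dots> \<le> 1 / 2 * (N * \<rho> x * exp (l * t))"
    proof (rule mult_right_mono)
      \<comment> \<open>The constant 16 in \<open>Q\<close> makes the Duhamel part at most half of
        the old bound; \<open>exp (2 * T)\<close> comes from the doubled time in the kernel
        bound.\<close>
      have "8 * L * (exp (2 * T) * T powr (1/4)) \<le> 8 * (L + 1) * (exp (2 * T) * T powr (1/4))"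
        by (intro mult_right_mono) auto
      also have "\<dots> = Q / 2" by (simp add: Q)
      finally show "8 * L * exp (2 * T) * T powr (1/4) / Q \<le> 1 / 2" using Q0 by (simp add: field_simps)
    qed (use N0 rho0[of x] in auto)
    finally have D: "\<bar>D\<bar> \<le> N / 2 * exp (l * t) * \<rho> x" by (simp add: mult_ac)
    have "\<bar>conv (heat_kernel t) (\<lambda>y. U 0 y - \<phi>) x\<bar> \<le> 1 * conv (heat_kernel t) (\<lambda>y. 1 * \<rho> y) x"
    proof (rule conv_abs_le)
      show "integrable lborel (\<lambda>y. heat_kernel t (x - y) * (1 * \<rho> y))"
        unfolding rho by (rule heat_conv_weight[OF t0])
    qed (use init t0 in auto)
    also have "\<dots> = d + A * (exp (k\<^sup>2 * t) * exp (- k * x))"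
      unfolding rho using heat_conv_weight(2)[OF t0, of 1 d A k x] by simp
    also have "\<dots> \<le> exp T * \<rho> x * 1" using grow[of t T x] t by simp
    also have "\<dots> \<le> exp T * \<rho> x * exp (l * t)" using lt rho0[of x] by (intro mult_left_mono) auto
    finally have 0: "\<bar>conv (heat_kernel t) (\<lambda>y. U 0 y - \<phi>) x\<bar> \<le> exp T * exp (l * t) * \<rho> x" by (simp add: mult_ac)
    have "conv (heat_kernel t) (\<lambda>y. U 0 y - \<phi>) x = conv (heat_kernel t) (U 0) x - \<phi>"
      by (subst conv_diff[OF gaussian_family_heat_kernel t0 U_measurable U_bound, of _ "\<bar>\<phi>\<bar>"])
         (auto simp: heat_conv_const[OF t0])
    then have "U t x - \<phi> = conv (heat_kernel t) (\<lambda>y. U 0 y - \<phi>) x + D"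
      using mild[OF t0 t(2), of x] by (simp add: D_def)
    then have "\<bar>U t x - \<phi>\<bar> \<le> exp T * exp (l * t) * \<rho> x + N / 2 * exp (l * t) * \<rho> x"
      using 0 D by linarith
    then show ?thesis by (simp add: algebra_simps)
  qed
  then show ?thesis using N0 by (simp add: weighted_bound_def)
qed

text \<open>The constant \<open>3 * exp T * exp (l * T)\<close> reached by the weighted estimate
  depends only on \<open>T\<close> and \<open>L\<close>, so the floor \<open>d\<close> of the weight
  can be chosen afterwards in terms of \<open>\<eta>\<close>. The sign of \<open>k\<close> selects
  the end of the line.\<close>

lemma spatial_limit_preserved:
  assumes phi: "\<phi> \<in> {-M..M}" and k: "k\<^sup>2 = 1"
    and lim: "\<And>\<delta>. \<delta> > 0 \<Longrightarrow> \<exists>X. \<forall>x. k * x \<ge> X \<longrightarrow> \<bar>U 0 x - \<phi>\<bar> \<le> \<delta>"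
    and h: "\<eta> > 0"
  shows "\<exists>X. \<forall>t x. 0 \<le> t \<longrightarrow> t \<le> T \<longrightarrow> k * x \<ge> X \<longrightarrow> \<bar>U t x - \<phi>\<bar> \<le> \<eta>"
proof -
  define Q where "Q = 16 * (L + 1) * exp (2 * T) * T powr (1/4)"
  define l where "l = Q ^ 4"
  define P where "P = 3 * exp T * exp (l * T)"
  have P: "P > 0" by (simp add: P_def)
  have l0: "l \<ge> 0" by (simp add: l_def)
  define d where "d = \<eta> / (2 * P)"
  have d: "d > 0" using P h by (simp add: d_def)
  obtain X where X: "\<And>x. k * x \<ge> X \<Longrightarrow> \<bar>U 0 x - \<phi>\<bar> \<le> d" using lim[OF d] by blast
  \<comment> \<open>Where \<open>k * x < X\<close>, the weight has to exceed the trivial bound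
    \<open>2 * M\<close>.\<close>
  define A where "A = 2 * M * exp X"
  have A: "A \<ge> 0" using M_nonneg by (simp add: A_def)
  define \<rho> where "\<rho> = (\<lambda>x. d + A * exp (- k * x))"
  have dist: "\<bar>U t x - \<phi>\<bar> \<le> 2 * M" for t x using U_bound[of t x] phi by (auto simp: abs_le_iff)
  have init: "\<bar>U 0 x - \<phi>\<bar> \<le> \<rho> x" for x
  proof (cases "k * x \<ge> X")
    case True
    then show ?thesis using X[OF True] A by (simp add: \<rho>_def add_increasing2)
  next
    case False
    then have "1 \<le> exp (X - k * x)" by simp
    then have "2 * M * 1 \<le> 2 * M * exp (X - k * x)" using M_nonneg by (intro mult_left_mono) auto
    also have "\<dots> = A * exp (- k * x)" by (simp add: A_def exp_diff exp_minus divide_inverse)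
    finally show ?thesis using dist[of 0 x] d by (simp add: \<rho>_def)
  qed
  define S where "S = {N. weighted_bound \<phi> l \<rho> N}"
  have step: "exp T + N / 2 \<in> S" if "N \<in> S" for N
    using weighted_bound_step[OF phi k d A \<rho>_def init l_def Q_def] that by (simp add: S_def)
  have "weighted_bound \<phi> l \<rho> (2 * M / d)"
    unfolding weighted_bound_def
  proof (intro conjI allI impI)
    show "0 \<le> 2 * M / d" using M_nonneg d by simp
    fix t x assume t: "0 \<le> t" "t \<le> T"
    have "2 * M = 2 * M / d * 1 * d" using d by simp
    also have "\<dots> \<le> 2 * M / d * exp (l * t) * \<rho> x"
      using M_nonneg d A l0 t by (intro mult_mono) (auto simp: \<rho>_def)
    finally show "\<bar>U t x - \<phi>\<bar> \<le> 2 * M / d * exp (l * t) * \<rho> x" using dist[of t x] by linarith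
  qed
  then have ne: "S \<noteq> {}" by (auto simp: S_def)
  have bb: "bdd_below S" by (rule bdd_belowI[of _ 0]) (simp add: S_def weighted_bound_def)
  \<comment> \<open>An infimum replaces the iteration: \<open>S\<close> is stable under
    \<open>N \<mapsto> exp T + N / 2\<close>, so its infimum is at most the fixed point
    \<open>2 * exp T\<close>. The floor \<open>d > 0\<close> of the weight is what makes
    \<open>S\<close> nonempty.\<close>
  have "2 * (Inf S - exp T) \<le> Inf S"
  proof (rule cInf_greatest[OF ne])
    fix N assume "N \<in> S"
    then have "Inf S \<le> exp T + N / 2" using cInf_lower[OF step bb] by blast
    then show "2 * (Inf S - exp T) \<le> N" by simp
  qed
  then have "Inf S \<le> 2 * exp T" by simp
  also have "\<dots> < 3 * exp T" by simp
  finally have "Inf S < 3 * exp T" .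
  then obtain N where N: "N \<in> S" "N < 3 * exp T" using cInf_lessD[OF ne] by blast
  define X' where "X' = ln ((A + 1) / d)"
  show ?thesis
  proof (intro exI[of _ X'] allI impI)
    fix t x assume t: "0 \<le> t" "t \<le> T" and x: "X' \<le> k * x"
    have "exp (- k * x) \<le> exp (- X')" using x by simp
    also have "\<dots> = d / (A + 1)" using A d by (simp add: X'_def exp_minus field_simps)
    finally have "A * exp (- k * x) \<le> A * (d / (A + 1))" using A by (intro mult_left_mono)
    also have "\<dots> \<le> d" using A d by (simp add: field_simps)
    finally have r: "\<rho> x \<le> 2 * d" by (simp add: \<rho>_def)
    have "\<bar>U t x - \<phi>\<bar> \<le> N * exp (l * t) * \<rho> x" using N(1) t by (simp add: S_def weighted_bound_def)
    also have "\<dots> \<le> 3 * exp T * exp (l * T) * (2 * d)"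
    proof (intro mult_mono r)
      show "0 \<le> \<rho> x" using d A by (simp add: \<rho>_def)
      show "exp (l * t) \<le> exp (l * T)" using l0 t by (simp add: mult_left_mono)
    qed (use N in auto)
    also have "\<dots> = \<eta>" unfolding P_def[symmetric] using P by (simp add: d_def)
    finally show "\<bar>U t x - \<phi>\<bar> \<le> \<eta>" .
  qed
qed

end

section \<open>The energy identity for the mollified solution\<close>

text \<open>The exponent is at least two because the positive part itself has a corner at 0; there
  the difference quotient is bounded by \<open>\<bar>h\<bar> ^ Suc n\<close>.\<close>

lemma has_real_derivative_pos_part_power:
  "((\<lambda>y. max 0 y ^ Suc (Suc n)) has_real_derivative real (Suc (Suc n)) * max 0 y ^ Suc n) (at (y::real))"
proof -
  consider "y > 0" | "y < 0" | "y = 0" by linarith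
  then show ?thesis
  proof cases
    case 1
    have "((\<lambda>y. y ^ Suc (Suc n)) has_real_derivative real (Suc (Suc n)) * y ^ Suc n) (at y)"
      using DERIV_pow[of "Suc (Suc n)" y] by simp
    then have "((\<lambda>y. max 0 y ^ Suc (Suc n)) has_real_derivative real (Suc (Suc n)) * y ^ Suc n) (at y)"
      by (rule has_field_derivative_transform_within_open[where S = "{0<..}"]) (use 1 in auto)
    then show ?thesis using 1 by simp
  next
    case 2
    have "((\<lambda>y. max 0 y ^ Suc (Suc n)) has_real_derivative 0) (at y)"
      by (rule has_field_derivative_transform_within_open[where S = "{..<0}", OF DERIV_const[of 0]])
         (use 2 in auto)
    then show ?thesis using 2 by simp
  next
    case 3
    have "((\<lambda>h::real. max 0 h ^ Suc (Suc n) / h) \<longlongrightarrow> 0) (at 0)"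
    proof (rule Lim_null_comparison)
      have "norm (max 0 h ^ Suc (Suc n) / h) \<le> \<bar>h\<bar> ^ Suc n" for h :: real
      proof (cases "h > 0")
        case False
        then have "norm (max 0 h ^ Suc (Suc n) / h) = 0" by simp
        also have "\<dots> \<le> \<bar>h\<bar> ^ Suc n" by (intro zero_le_power) simp
        finally show ?thesis .
      qed simp
      then show "\<forall>\<^sub>F h::real in at 0. norm (max 0 h ^ Suc (Suc n) / h) \<le> \<bar>h\<bar> ^ Suc n" by simp
      have "((\<lambda>h::real. \<bar>h\<bar> ^ Suc n) \<longlongrightarrow> \<bar>0\<bar> ^ Suc n) (at 0)" by (intro tendsto_intros)
      then show "((\<lambda>h::real. \<bar>h\<bar> ^ Suc n) \<longlongrightarrow> 0) (at 0)" by simp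
    qed
    then show ?thesis using 3 by (simp add: DERIV_def)
  qed
qed

lemma has_real_derivative_gap_power:
  "((\<lambda>v. max 0 (c - v) ^ Suc (Suc n)) has_real_derivative - (real (Suc (Suc n)) * max 0 (c - v) ^ Suc n)) (at (v::real))"
proof -
  have "((\<lambda>v. c - v) has_real_derivative - 1) (at v)" by (auto intro!: derivative_eq_intros)
  from DERIV_chain2[OF has_real_derivative_pos_part_power this] show ?thesis by simp
qed

lemma has_real_derivative_gap_cube:
  assumes "(g has_real_derivative g') (at x)"
  shows "((\<lambda>x. max 0 (c - g x) ^ 3) has_real_derivative - 3 * max 0 (c - g x) ^ 2 * g') (at x)"
  using DERIV_chain2[OF has_real_derivative_gap_power[of c 1] assms] by (simp add: numeral_eq_Suc)

lemma has_real_derivative_gap_square: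
  assumes "(g has_real_derivative g') (at x)"
  shows "((\<lambda>x. max 0 (c - g x) ^ 2) has_real_derivative - 2 * max 0 (c - g x) * g') (at x)"
  using DERIV_chain2[OF has_real_derivative_gap_power[of c 0] assms] by (simp add: numeral_eq_Suc)

lemma gap_cube_diff_le:
  fixes a b c K :: real
  assumes "c - a \<le> K" "c - b \<le> K" "K \<ge> 0"
  shows "\<bar>max 0 (c - a) ^ 3 - max 0 (c - b) ^ 3\<bar> \<le> 3 * K\<^sup>2 * \<bar>a - b\<bar>"
proof -
  define p q where "p = max 0 (c - a)" and "q = max 0 (c - b)"
  have pq: "0 \<le> p" "p \<le> K" "0 \<le> q" "q \<le> K" "\<bar>p - q\<bar> \<le> \<bar>a - b\<bar>"
    using assms by (auto simp: p_def q_def)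
  have "p ^ 3 - q ^ 3 = (p\<^sup>2 + p * q + q\<^sup>2) * (p - q)"
    by (simp add: power3_eq_cube power2_eq_square algebra_simps)
  then have "\<bar>p ^ 3 - q ^ 3\<bar> = (p\<^sup>2 + p * q + q\<^sup>2) * \<bar>p - q\<bar>" using pq by (simp add: abs_mult)
  also have "\<dots> \<le> (3 * K\<^sup>2) * \<bar>a - b\<bar>"
  proof (intro mult_mono pq)
    have "p\<^sup>2 \<le> K\<^sup>2" "q\<^sup>2 \<le> K\<^sup>2" using pq by (auto intro: power_mono)
    moreover have "p * q \<le> K * K" using pq by (intro mult_mono) auto
    ultimately show "p\<^sup>2 + p * q + q\<^sup>2 \<le> 3 * K\<^sup>2" by (simp add: power2_eq_square)
  qed auto
  finally show ?thesis by (simp add: p_def q_def)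
qed

text \<open>All estimates take place on the fixed interval \<open>[-R,R]\<close>:
  \<open>boundary\<close> removes the boundary terms in the integrations by parts, and
  \<open>flux_error\<close> measures how far the mollified flux is from a function of the mollified
  solution.\<close>

locale mollified_flow = mild_flow +
  fixes c R e \<delta> :: real
  assumes R_pos: "R > 0" and e_pos: "e > 0" and delta_nonneg: "\<delta> \<ge> 0"
    and boundary: "\<And>t. \<lbrakk>0 \<le> t; t \<le> T\<rbrakk> \<Longrightarrow> c \<le> conv (heat_kernel e) (U t) R"
      "\<And>t. \<lbrakk>0 \<le> t; t \<le> T\<rbrakk> \<Longrightarrow> c \<le> conv (heat_kernel e) (U t) (- R)"
    and flux_error: "\<And>t x. \<lbrakk>0 \<le> t; t \<le> T\<rbrakk> \<Longrightarrow>
       \<bar>conv (heat_kernel e) (F t) x - f (conv (heat_kernel e) (U t) x)\<bar> \<le> \<delta>"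
begin

definition a :: "real \<Rightarrow> real \<Rightarrow> real" where "a t = conv (heat_kernel e) (U t)"
definition ax :: "real \<Rightarrow> real \<Rightarrow> real" where "ax t = conv (heat_kernel_dx e) (U t)"
definition axx :: "real \<Rightarrow> real \<Rightarrow> real" where "axx t = conv (heat_kernel_dxx e) (U t)"
definition G :: "real \<Rightarrow> real \<Rightarrow> real" where "G t = conv (heat_kernel e) (F t)"
definition Gx :: "real \<Rightarrow> real \<Rightarrow> real" where "Gx t = conv (heat_kernel_dx e) (F t)"
definition w :: "real \<Rightarrow> real \<Rightarrow> real" where "w t x = max 0 (c - a t x)"
definition E :: "real \<Rightarrow> real" where "E t = integral {-R..R} (\<lambda>x. w t x ^ 3)"
definition D :: "real \<Rightarrow> real" where "D t = integral {-R..R} (\<lambda>x. w t x * (ax t x)\<^sup>2)"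
definition K :: real where "K = \<bar>c\<bar> + M"

lemma a_bound: "\<bar>a t x\<bar> \<le> M"
  unfolding a_def by (rule heat_conv_abs_le[OF e_pos U_bound])

lemma K_nonneg: "K \<ge> 0" using M_nonneg by (simp add: K_def)

lemma w_bounds: "0 \<le> w t x" "w t x \<le> K"
  using a_bound[of t x] K_nonneg by (auto simp: w_def K_def)

lemma a_deriv_x: "(a t has_real_derivative ax t x) (at x)"
  and ax_deriv_x: "(ax t has_real_derivative axx t x) (at x)"
  unfolding a_def ax_def axx_def by (rule heat_conv_has_derivative_x[OF e_pos U_measurable U_bound])+

lemma G_deriv_x: "(G t has_real_derivative Gx t x) (at x)"
  unfolding G_def Gx_def by (rule heat_conv_has_derivative_x[OF e_pos F_measurable F_bound])

lemma a_deriv_t: "0 < t \<Longrightarrow> t < T \<Longrightarrow> ((\<lambda>t. a t x) has_real_derivative axx t x + Gx t x) (at t)"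
  unfolding a_def axx_def Gx_def by (rule mollified_has_derivative_t[OF _ _ e_pos])

lemma continuous_intros_flow:
  assumes "continuous_on S b" "continuous_on S d"
  shows "continuous_on S (\<lambda>p. a (b p) (d p))" "continuous_on S (\<lambda>p. ax (b p) (d p))"
    "continuous_on S (\<lambda>p. axx (b p) (d p))" "continuous_on S (\<lambda>p. G (b p) (d p))"
    "continuous_on S (\<lambda>p. Gx (b p) (d p))" "continuous_on S (\<lambda>p. w (b p) (d p))"
proof -
  show 1: "continuous_on S (\<lambda>p. a (b p) (d p))" unfolding a_def
    by (rule continuous_on_conv_U) (use assms e_pos gaussian_family_heat_kernel in auto)
  show "continuous_on S (\<lambda>p. ax (b p) (d p))" unfolding ax_def
    by (rule continuous_on_conv_U) (use assms e_pos gaussian_family_heat_kernel_dx in auto)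
  show "continuous_on S (\<lambda>p. axx (b p) (d p))" unfolding axx_def
    by (rule continuous_on_conv_U) (use assms e_pos gaussian_family_heat_kernel_dxx in auto)
  show "continuous_on S (\<lambda>p. G (b p) (d p))" unfolding G_def
    by (rule continuous_on_conv_F) (use assms e_pos gaussian_family_heat_kernel in auto)
  show "continuous_on S (\<lambda>p. Gx (b p) (d p))" unfolding Gx_def
    by (rule continuous_on_conv_F) (use assms e_pos gaussian_family_heat_kernel_dx in auto)
  show "continuous_on S (\<lambda>p. w (b p) (d p))" unfolding w_def
    by (intro continuous_intros 1)
qed

lemma D_nonneg: "D t \<ge> 0"
  unfolding D_def using w_bounds
  by (intro integral_nonneg integrable_continuous_real continuous_intros continuous_intros_flow) auto

lemma w_boundary: "0 \<le> t \<Longrightarrow> t \<le> T \<Longrightarrow> w t R = 0" "0 \<le> t \<Longrightarrow> t \<le> T \<Longrightarrow> w t (- R) = 0"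
  using boundary[of t] by (auto simp: w_def a_def)

lemma E_has_derivative:
  assumes t: "0 < t" "t < T"
  shows "(E has_real_derivative integral {-R..R} (\<lambda>x. - 3 * w t x ^ 2 * (axx t x + Gx t x))) (at t)"
proof -
  have "((\<lambda>t. integral (cbox (-R) R) (\<lambda>x. w t x ^ 3)) has_real_derivative
      integral (cbox (-R) R) (\<lambda>x. - 3 * w t x ^ 2 * (axx t x + Gx t x))) (at t within {0<..<T})"
  proof (rule leibniz_rule_field_derivative[where fx = "\<lambda>t x. - 3 * w t x ^ 2 * (axx t x + Gx t x)"])
    show "((\<lambda>t. w t x ^ 3) has_real_derivative - 3 * w t x ^ 2 * (axx t x + Gx t x)) (at t within {0<..<T})"
      if "t \<in> {0<..<T}" for t x
      unfolding w_def using that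
      by (intro has_field_derivative_at_within[OF has_real_derivative_gap_cube] a_deriv_t) auto
    show "(\<lambda>x. w t x ^ 3) integrable_on cbox (-R) R" for t
      by (simp, intro integrable_continuous_real continuous_intros continuous_intros_flow)
    show "continuous_on ({0<..<T} \<times> cbox (- R) R) (\<lambda>(t, x). - 3 * w t x ^ 2 * (axx t x + Gx t x))"
      unfolding case_prod_beta by (intro continuous_intros continuous_intros_flow)
  qed (use t in auto)
  then show ?thesis
    using at_within_open[of t "{0<..<T}"] t by (simp add: E_def[abs_def])
qed

text \<open>Integration by parts. The exact flux contributes \<open>6 w f(a) a\<^sub>x\<close>, which is the \<open>x\<close>-derivative of a
  function of \<open>a\<close> that vanishes where \<open>a \<ge> c\<close>; only the mollification error of the flux survives.\<close>

lemma E_dissipation: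
  assumes t: "0 \<le> t" "t \<le> T"
  shows "integral {-R..R} (\<lambda>x. - 3 * w t x ^ 2 * (axx t x + Gx t x)) \<le> - 3 * D t + 6 * R * K * \<delta>\<^sup>2"
proof -
  \<comment> \<open>Truncating the argument makes the flux continuous on the whole line; the values
    of \<open>a\<close> lie in \<open>[-M,M]\<close>, where the truncation is invisible.\<close>
  define g where "g v = 6 * max 0 (c - v) * f (max (-M) (min M v))" for v
  have g_cont: "continuous_on S g" for S
  proof -
    have "continuous_on S (\<lambda>v. f (max (-M) (min M v)))"
      by (rule continuous_on_compose2[OF lipschitz_on_continuous_on[OF f_lipschitz]])
         (use M_nonneg in \<open>auto intro!: continuous_intros\<close>)
    then show ?thesis unfolding g_def by (intro continuous_intros)
  qed
  \<comment> \<open>The upper end \<open>M + 1\<close> lies beyond the range of \<open>a\<close>, so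
    \<open>H\<close> has a two-sided derivative even at \<open>v = M\<close>. Integrating from
    \<open>v\<close> upwards makes \<open>H\<close> vanish for \<open>v \<ge> c\<close>, where
    \<open>g\<close> is zero.\<close>
  define H where "H v = integral {v..M + 1} g" for v
  have H_deriv: "(H has_real_derivative - g v) (at v)" if "\<bar>v\<bar> \<le> M" for v
  proof -
    have "(H has_real_derivative - g v) (at v within {- M - 1..M + 1})"
      unfolding H_def using that by (intro integral_has_real_derivative' g_cont) auto
    moreover have "at v within {- M - 1..M + 1} = at v"
      by (rule at_within_interior) (use that in auto)
    ultimately show ?thesis by simp
  qed
  have H0: "H v = 0" if "c \<le> v" for v
    unfolding H_def by (rule integral_unique, rule has_integral_is_0) (use that in \<open>auto simp: g_def\<close>)
  \<comment> \<open>Collects the boundary terms, which vanish at both ends. Its derivative is the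
    integrand to be estimated, up to the dissipation and the flux error \<open>q\<close>.\<close>
  define P where "P x = - 3 * w t x ^ 2 * (ax t x + G t x) + H (a t x)" for x
  define q where "q x = G t x - f (a t x)" for x
  define P' where "P' x = 6 * w t x * ax t x * (ax t x + q x) - 3 * w t x ^ 2 * (axx t x + Gx t x)" for x
  have "(P has_real_derivative P' x) (at x)" for x
  proof -
    have 1: "((\<lambda>x. w t x ^ 2) has_real_derivative - 2 * w t x * ax t x) (at x)"
      unfolding w_def by (rule has_real_derivative_gap_square[OF a_deriv_x])
    have 2: "((\<lambda>x. H (a t x)) has_real_derivative - g (a t x) * ax t x) (at x)"
      by (rule DERIV_chain2[OF H_deriv[OF a_bound] a_deriv_x])
    have 3: "g (a t x) = 6 * w t x * f (a t x)"
      using a_bound[of t x] by (simp add: g_def w_def abs_le_iff)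
    have "((\<lambda>x. - 3 * w t x ^ 2) has_real_derivative - 3 * (- 2 * w t x * ax t x)) (at x)"
      by (rule DERIV_cmult[OF 1])
    from DERIV_add[OF DERIV_mult[OF this DERIV_add[OF ax_deriv_x[of t x] G_deriv_x[of t x]]] 2]
    show ?thesis
      unfolding P_def P'_def q_def 3 by (rule DERIV_cong) (simp add: algebra_simps)
  qed
  then have "(P has_vector_derivative P' x) (at x within {-R..R})" for x
    unfolding has_real_derivative_iff_has_vector_derivative[symmetric]
    by (rule has_field_derivative_at_within)
  then have "(P' has_integral (P R - P (- R))) {-R..R}"
    using R_pos by (intro fundamental_theorem_of_calculus) auto
  moreover have "P R = 0" "P (- R) = 0"
    using w_boundary[OF t] boundary[OF t] by (simp_all add: P_def H0 a_def)
  ultimately have P': "(P' has_integral 0) {-R..R}" by simp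
  have Dint: "((\<lambda>x. w t x * (ax t x)\<^sup>2) has_integral D t) {-R..R}"
    unfolding D_def
    by (intro integrable_integral integrable_continuous_real continuous_intros continuous_intros_flow)
  have "((\<lambda>x. P' x + (- 3 * (w t x * (ax t x)\<^sup>2) + 3 * K * \<delta>\<^sup>2)) has_integral
      (0 + (- 3 * D t + (R - (- R)) * (3 * K * \<delta>\<^sup>2)))) {-R..R}"
    using R_pos has_integral_const_real[of "3 * K * \<delta>\<^sup>2" "-R" R]
    by (intro has_integral_add P' has_integral_mult_right Dint) auto
  moreover have "(\<lambda>x. - 3 * w t x ^ 2 * (axx t x + Gx t x)) integrable_on {-R..R}"
    by (intro integrable_continuous_real continuous_intros continuous_intros_flow)
  moreover have "- 3 * w t x ^ 2 * (axx t x + Gx t x)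
      \<le> P' x + (- 3 * (w t x * (ax t x)\<^sup>2) + 3 * K * \<delta>\<^sup>2)" for x
  proof -
    have "\<bar>q x\<bar> \<le> \<delta>" using flux_error[OF t, of x] by (simp add: q_def G_def a_def)
    then have "(q x)\<^sup>2 \<le> \<delta>\<^sup>2" using abs_le_square_iff[of "q x" \<delta>] delta_nonneg by simp
    then have 1: "w t x * (q x)\<^sup>2 \<le> K * \<delta>\<^sup>2" using w_bounds[of t x] by (intro mult_mono) auto
    \<comment> \<open>This square absorbs the mixed term at the cost of half the dissipation, 3 in
      place of 6. What remains is at most \<open>3 K \<delta>^2\<close> on an interval of length
      \<open>2 R\<close>.\<close>
    have "0 \<le> w t x * (ax t x + q x)\<^sup>2" using w_bounds by simp
    then have "- 6 * w t x * ax t x * (ax t x + q x) \<le> - 3 * (w t x * (ax t x)\<^sup>2) + 3 * (w t x * (q x)\<^sup>2)"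
      by (simp add: power2_eq_square algebra_simps)
    with 1 show ?thesis by (simp add: P'_def)
  qed
  ultimately have "integral {-R..R} (\<lambda>x. - 3 * w t x ^ 2 * (axx t x + Gx t x))
      \<le> 0 + (- 3 * D t + (R - (- R)) * (3 * K * \<delta>\<^sup>2))"
    by (intro has_integral_le[OF integrable_integral]) auto
  then show ?thesis by (simp add: algebra_simps)
qed

text \<open>The mean value theorem does the averaging in time: it exhibits one instant whose
  dissipation is controlled by the energy drop, without integrating \<open>D\<close> over
  time.\<close>

lemma E_step:
  assumes t: "0 \<le> t1" "t1 < t2" "t2 \<le> T"
  obtains z where "t1 < z" "z < t2" "E t2 - E t1 \<le> (t2 - t1) * (- 3 * D z + 6 * R * K * \<delta>\<^sup>2)"
proof -
  have cont: "continuous_on {t1..t2} E"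
    unfolding E_def[abs_def] cbox_interval[symmetric]
    by (rule integral_continuous_on_param)
       (auto simp: case_prod_beta intro!: continuous_intros continuous_intros_flow)
  have der: "(E has_real_derivative integral {-R..R} (\<lambda>x. - 3 * w s x ^ 2 * (axx s x + Gx s x))) (at s)"
    if "t1 < s" "s < t2" for s
    using t that by (intro E_has_derivative) auto
  obtain l z where z: "t1 < z" "z < t2" "(E has_real_derivative l) (at z)" "E t2 - E t1 = (t2 - t1) * l"
    using MVT[OF t(2) cont] der by (meson real_differentiable_def)
  have "l = integral {-R..R} (\<lambda>x. - 3 * w z x ^ 2 * (axx z x + Gx z x))"
    using z der DERIV_unique by blast
  then have "l \<le> - 3 * D z + 6 * R * K * \<delta>\<^sup>2"
    using E_dissipation[of z] z t by simp
  then show ?thesis using that[of z] z t by (simp add: mult_left_mono)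
qed

lemma E_le:
  assumes t: "0 \<le> t1" "t1 < t2" "t2 \<le> T"
  shows "E t2 \<le> E t1 + (t2 - t1) * (6 * R * K * \<delta>\<^sup>2)"
proof -
  obtain z where "E t2 - E t1 \<le> (t2 - t1) * (- 3 * D z + 6 * R * K * \<delta>\<^sup>2)"
    using E_step[OF t] by blast
  also have "\<dots> \<le> (t2 - t1) * (6 * R * K * \<delta>\<^sup>2)" using t D_nonneg[of z] by (intro mult_left_mono) auto
  finally show ?thesis by simp
qed

text \<open>Between \<open>x\<close> and \<open>R\<close>, where \<open>w\<close> vanishes,
  \<open>w^3\<close> changes by the integral of \<open>3 w^2 ax\<close>, and Young's inequality with
  weight \<open>m\<close> splits the integrand. Optimising in \<open>m\<close> would bound the
  square by \<open>9 E D\<close>; a free \<open>m\<close> lets separate bounds on \<open>E\<close>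
  and \<open>D\<close> be inserted directly.\<close>

lemma w_cube_le:
  assumes t: "0 \<le> t" "t \<le> T" and x: "x \<in> {-R..R}" and m: "m > 0"
  shows "w t x ^ 3 \<le> 3 / 2 * (m * E t + D t / m)"
proof -
  define r where "r y = 3 / 2 * (m * w t y ^ 3 + w t y * (ax t y)\<^sup>2 / m)" for y
  have r_cont: "continuous_on S r" for S
    unfolding r_def using m by (intro continuous_intros continuous_intros_flow) auto
  have "((\<lambda>y. w t y ^ 3) has_real_derivative - 3 * w t y ^ 2 * ax t y) (at y)" for y
    unfolding w_def by (rule has_real_derivative_gap_cube[OF a_deriv_x])
  then have "((\<lambda>y. w t y ^ 3) has_vector_derivative - 3 * w t y ^ 2 * ax t y) (at y within {x..R})" for y
    unfolding has_real_derivative_iff_has_vector_derivative[symmetric]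
    by (rule has_field_derivative_at_within)
  then have "((\<lambda>y. - 3 * w t y ^ 2 * ax t y) has_integral (w t R ^ 3 - w t x ^ 3)) {x..R}"
    using x by (intro fundamental_theorem_of_calculus) auto
  from has_integral_neg[OF this]
  have "((\<lambda>y. 3 * w t y ^ 2 * ax t y) has_integral w t x ^ 3) {x..R}"
    using w_boundary(1)[OF t] by simp
  moreover have "r integrable_on {x..R}" by (intro integrable_continuous_real r_cont)
  moreover have "3 * w t y ^ 2 * ax t y \<le> r y" for y
  proof -
    have "0 \<le> (m * w t y - ax t y)\<^sup>2 / m" using m by simp
    also have "\<dots> = m * (w t y)\<^sup>2 - 2 * w t y * ax t y + (ax t y)\<^sup>2 / m"
      using m by (simp add: power2_eq_square field_simps)
    finally have "0 \<le> 3 / 2 * w t y * (m * (w t y)\<^sup>2 - 2 * w t y * ax t y + (ax t y)\<^sup>2 / m)"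
      using w_bounds by simp
    also have "\<dots> = r y - 3 * w t y ^ 2 * ax t y"
      by (simp add: r_def power2_eq_square power3_eq_cube algebra_simps)
    finally show ?thesis by simp
  qed
  ultimately have "w t x ^ 3 \<le> integral {x..R} r"
    by (intro has_integral_le[OF _ integrable_integral]) auto
  also have "\<dots> \<le> integral {-R..R} r"
    using x m w_bounds
    by (intro integral_subset_le integrable_continuous_real r_cont) (auto simp: r_def)
  also have "\<dots> = 3 / 2 * (m * E t + D t / m)"
  proof (rule integral_unique)
    have "((\<lambda>x. w t x ^ 3) has_integral E t) {-R..R}" "((\<lambda>x. w t x * (ax t x)\<^sup>2) has_integral D t) {-R..R}"
      unfolding E_def D_def
      by (intro integrable_integral integrable_continuous_real continuous_intros continuous_intros_flow)+
    then show "(r has_integral 3 / 2 * (m * E t + D t / m)) {-R..R}"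
      unfolding r_def by (intro has_integral_mult_right has_integral_add has_integral_divide)
  qed
  finally show ?thesis .
qed

end

section \<open>Positivity\<close>

context mild_flow
begin

text \<open>The margin between \<open>c'\<close> and \<open>c\<close> absorbs the mollification
  error at \<open>R\<close> and \<open>- R\<close>, so the mollified gap still vanishes
  there.\<close>

lemma obtain_mollified_flow:
  assumes R: "R > 0" and far: "\<And>t x. \<lbrakk>0 \<le> t; t \<le> T; \<bar>x\<bar> \<ge> R\<rbrakk> \<Longrightarrow> c' \<le> U t x"
    and d: "\<delta> > 0" "\<delta> \<le> c' - c"
  obtains e where "mollified_flow f U T M L c R e \<delta>"
    "\<And>t x. \<lbrakk>0 \<le> t; t \<le> T\<rbrakk> \<Longrightarrow> \<bar>conv (heat_kernel e) (U t) x - U t x\<bar> \<le> \<delta>"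
proof -
  obtain r0 where r0: "r0 > 0"
    "\<And>r t x. \<lbrakk>0 < r; r < r0; 0 \<le> t; t \<le> T\<rbrakk> \<Longrightarrow> \<bar>conv (heat_kernel r) (U t) x - U t x\<bar> \<le> \<delta>"
    "\<And>r t x. \<lbrakk>0 < r; r < r0; 0 \<le> t; t \<le> T\<rbrakk> \<Longrightarrow>
       \<bar>conv (heat_kernel r) (F t) x - f (conv (heat_kernel r) (U t) x)\<bar> \<le> \<delta>"
    using mollified_uniform[OF d(1)] by blast
  define e where "e = r0 / 2"
  have e: "0 < e" "e < r0" using r0(1) by (auto simp: e_def)
  have "mollified_flow f U T M L c R e \<delta>"
  proof unfold_locales
    show "c \<le> conv (heat_kernel e) (U t) R" if "0 \<le> t" "t \<le> T" for t
      using r0(2)[OF e that, of R] far[OF that, of R] R d by linarith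
    show "c \<le> conv (heat_kernel e) (U t) (- R)" if "0 \<le> t" "t \<le> T" for t
      using r0(2)[OF e that, of "- R"] far[OF that, of "- R"] R d by linarith
  qed (use e R d r0(3) in auto)
  then show ?thesis using that r0(2)[OF e] by blast
qed

definition energy :: "real \<Rightarrow> real \<Rightarrow> real \<Rightarrow> real" where
  "energy c R t = integral {-R..R} (\<lambda>x. max 0 (c - U t x) ^ 3)"

lemma U_continuous_x: "continuous_on S (U t)"
  using U_unif_cont[of t] uniformly_continuous_imp_continuous continuous_on_subset by blast

end

context mollified_flow
begin

lemma energy_close:
  assumes d: "\<And>x. \<bar>conv (heat_kernel e) (U t) x - U t x\<bar> \<le> d"
  shows "\<bar>E t - energy c R t\<bar> \<le> 6 * R * K\<^sup>2 * d"
proof -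
  have "E t - energy c R t = integral {-R..R} (\<lambda>x. w t x ^ 3 - max 0 (c - U t x) ^ 3)"
    unfolding E_def energy_def
    by (rule Henstock_Kurzweil_Integration.integral_diff[symmetric];
        intro integrable_continuous_real continuous_intros continuous_intros_flow U_continuous_x)
  also have "norm \<dots> \<le> (3 * K\<^sup>2 * d) * (R - (- R))"
  proof (rule integral_bound)
    show "continuous_on {-R..R} (\<lambda>x. w t x ^ 3 - max 0 (c - U t x) ^ 3)"
      by (intro continuous_intros continuous_intros_flow U_continuous_x)
    fix x
    have "\<bar>w t x ^ 3 - max 0 (c - U t x) ^ 3\<bar> \<le> 3 * K\<^sup>2 * \<bar>a t x - U t x\<bar>"
      unfolding w_def using a_bound[of t x] U_bound[of t x] K_nonneg
      by (intro gap_cube_diff_le) (auto simp: K_def)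
    also have "\<dots> \<le> 3 * K\<^sup>2 * d" using d[of x] by (intro mult_left_mono) (auto simp: a_def)
    finally show "norm (w t x ^ 3 - max 0 (c - U t x) ^ 3) \<le> 3 * K\<^sup>2 * d" by simp
  qed (use R_pos in auto)
  finally show ?thesis by (simp add: algebra_simps)
qed

end

context mild_flow
begin

text \<open>The mollified energy starts at zero, since averaging preserves a constant lower bound,
  and grows at most by the flux error. With \<open>R\<close> and the times fixed, all errors vanish
  as \<open>d\<close> tends to 0; the energy of \<open>U\<close> itself is then zero, and continuity
  forces the gap to vanish pointwise.\<close>

lemma lower_bound_preserved:
  assumes R: "R > 0" and far: "\<And>t x. \<lbrakk>0 \<le> t; t \<le> T; \<bar>x\<bar> \<ge> R\<rbrakk> \<Longrightarrow> c' \<le> U t x"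
    and c: "c < c'" and t: "0 \<le> t1" "t1 < t2" "t2 \<le> T" and init: "\<And>x. c \<le> U t1 x"
  shows "c \<le> U t2 x"
proof -
  define K where "K = \<bar>c\<bar> + M"
  have K: "K \<ge> 0" using M_nonneg by (simp add: K_def)
  have est: "energy c R t2 \<le> (t2 - t1) * (6 * R * K * d\<^sup>2) + 6 * R * K\<^sup>2 * d" if d: "d > 0" "d \<le> c' - c" for d
  proof -
    obtain e where "mollified_flow f U T M L c R e d"
      and close: "\<And>t x. \<lbrakk>0 \<le> t; t \<le> T\<rbrakk> \<Longrightarrow> \<bar>conv (heat_kernel e) (U t) x - U t x\<bar> \<le> d"
      using obtain_mollified_flow[OF R far d] by blast
    then interpret m: mollified_flow f U T M L c R e d by simp
    have "c \<le> m.a t1 x" for x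
    proof -
      have "conv (heat_kernel e) (\<lambda>_. c) x \<le> m.a t1 x"
        unfolding m.a_def
        by (rule heat_conv_mono[OF m.e_pos init, where B = "K"])
           (use U_bound M_nonneg in \<open>auto simp: K_def intro!: add_increasing\<close>)
      then show ?thesis by (simp add: heat_conv_const[OF m.e_pos])
    qed
    then have "m.E t1 = 0" by (simp add: m.E_def m.w_def)
    moreover have "\<bar>m.E t2 - energy c R t2\<bar> \<le> 6 * R * m.K\<^sup>2 * d"
      using t close by (intro m.energy_close) auto
    moreover have "m.K = K" by (simp add: m.K_def K_def)
    ultimately show ?thesis using m.E_le[OF t] by simp
  qed
  have lim: "((\<lambda>d. (t2 - t1) * (6 * R * K * d\<^sup>2) + 6 * R * K\<^sup>2 * d) \<longlongrightarrow>
      (t2 - t1) * (6 * R * K * 0\<^sup>2) + 6 * R * K\<^sup>2 * 0) (at_right 0)"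
    by (intro tendsto_intros)
  have ev: "\<forall>\<^sub>F d in at_right 0. energy c R t2 \<le> (t2 - t1) * (6 * R * K * d\<^sup>2) + 6 * R * K\<^sup>2 * d"
    using est c by (auto simp: eventually_at_right_field intro!: exI[of _ "c' - c"])
  have le: "energy c R t2 \<le> 0"
    using tendsto_lowerbound[OF lim ev] by simp
  have cont: "continuous_on {-R..R} (\<lambda>x. max 0 (c - U t2 x) ^ 3)"
    by (intro continuous_intros U_continuous_x)
  have "energy c R t2 \<ge> 0"
    unfolding energy_def by (intro integral_nonneg integrable_continuous_real cont) auto
  with le have "integral {-R..R} (\<lambda>x. max 0 (c - U t2 x) ^ 3) = 0" by (simp add: energy_def)
  then have zero: "\<forall>x\<in>{-R..R}. max 0 (c - U t2 x) ^ 3 = 0"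
    using R by (subst (asm) integral_eq_0_iff[OF cont]) auto
  show ?thesis
  proof (cases "\<bar>x\<bar> \<ge> R")
    case True
    then show ?thesis using far[of t2 x] t c by auto
  next
    case False
    then have "x \<in> {-R..R}" by auto
    with zero have "max 0 (c - U t2 x) ^ 3 = 0" by blast
    then show ?thesis by simp
  qed
qed

lemma lower_bound_attained:
  assumes R: "R > 0" and far: "\<And>t x. \<lbrakk>0 \<le> t; t \<le> T; \<bar>x\<bar> \<ge> R\<rbrakk> \<Longrightarrow> c' \<le> U t x"
    and c: "c < c'" and m: "m > 0" "m ^ 3 \<ge> 3 * (energy c R 0 + 2) / sqrt T"
  obtains z where "0 < z" "z < T" "\<And>x. c - 2 * m \<le> U z x"
proof -
  define K where "K = \<bar>c\<bar> + M"
  have K: "K \<ge> 0" using M_nonneg by (simp add: K_def)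
  have lim: "((\<lambda>d. 6 * R * K * d\<^sup>2) \<longlongrightarrow> 6 * R * K * 0\<^sup>2) (at_right 0)"
    "((\<lambda>d. 6 * R * K\<^sup>2 * d) \<longlongrightarrow> 6 * R * K\<^sup>2 * 0) (at_right 0)"
    by (intro tendsto_intros)+
  have "\<forall>\<^sub>F d in at_right 0. 6 * R * K * d\<^sup>2 < 1 / T" "\<forall>\<^sub>F d in at_right 0. 6 * R * K\<^sup>2 * d < 1"
    using order_tendstoD(2)[OF lim(1), of "1 / T"] order_tendstoD(2)[OF lim(2), of 1] T_pos by auto
  moreover have "\<forall>\<^sub>F d in at_right 0. 0 < d \<and> d < min m (c' - c)"
    using m c by (auto simp: eventually_at_right_field intro!: exI[of _ "min m (c' - c)"])
  ultimately have "\<forall>\<^sub>F d in at_right 0. 6 * R * K * d\<^sup>2 < 1 / T \<and> 6 * R * K\<^sup>2 * d < 1 \<and> 0 < d \<and> d < min m (c' - c)"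
    by eventually_elim auto
  from eventually_happens'[OF _ this]
  obtain d where d1: "6 * R * K * d\<^sup>2 < 1 / T" "6 * R * K\<^sup>2 * d < 1"
    and d2: "d > 0" "d \<le> c' - c" "d \<le> m"
    by (auto simp: less_imp_le)
  obtain e where "mollified_flow f U T M L c R e d"
    and close: "\<And>t x. \<lbrakk>0 \<le> t; t \<le> T\<rbrakk> \<Longrightarrow> \<bar>conv (heat_kernel e) (U t) x - U t x\<bar> \<le> d"
    using obtain_mollified_flow[OF R far d2(1,2)] by blast
  then interpret m: mollified_flow f U T M L c R e d by simp
  have mK: "m.K = K" by (simp add: m.K_def K_def)
  \<comment> \<open>One of the two extra units pays for mollifying the initial data, the other for
    the flux error accumulated over \<open>[0,T]\<close>; \<open>d\<close> is small enough that each
    is at most 1.\<close>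
  define E0 where "E0 = energy c R 0 + 2"
  have e0: "m.E 0 \<le> E0 - 1"
  proof -
    have "\<bar>m.E 0 - energy c R 0\<bar> \<le> 6 * R * m.K\<^sup>2 * d"
      using close T_pos by (intro m.energy_close) auto
    with d1(2) show ?thesis unfolding mK E0_def by linarith
  qed
  obtain z where z: "0 < z" "z < T" "m.E T - m.E 0 \<le> (T - 0) * (- 3 * m.D z + 6 * R * m.K * d\<^sup>2)"
    using m.E_step[of 0 T] T_pos by auto
  have ET: "m.E t \<ge> 0" for t
    unfolding m.E_def using m.w_bounds
    by (intro integral_nonneg integrable_continuous_real continuous_intros m.continuous_intros_flow) auto
  have Td: "T * (6 * R * K * d\<^sup>2) \<le> 1" using d1(1) T_pos by (simp add: field_simps)
  have "z * (6 * R * K * d\<^sup>2) \<le> T * (6 * R * K * d\<^sup>2)"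
    using z R K by (intro mult_right_mono) auto
  then have Ez: "m.E z \<le> E0"
    using m.E_le[of 0 z] z e0 Td unfolding mK by simp
  have "T * (3 * m.D z) = T * (6 * R * K * d\<^sup>2) - T * (- 3 * m.D z + 6 * R * K * d\<^sup>2)"
    by (simp add: algebra_simps)
  also have "\<dots> \<le> E0" using z(3) ET[of T] e0 Td unfolding mK by simp
  finally have "3 * (T * m.D z) \<le> E0" by simp
  moreover have "0 \<le> T * m.D z" using m.D_nonneg[of z] T_pos by simp
  ultimately have Dz: "T * m.D z \<le> E0" by linarith
  show ?thesis
  proof (rule that)
    show "0 < z" "z < T" by fact+
    fix x
    show "c - 2 * m \<le> U z x"
    proof (cases "\<bar>x\<bar> \<ge> R")
      case True
      then show ?thesis using far[of z x] z c m by auto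
    next
      case False
      \<comment> \<open>Balances the two terms: \<open>E\<close> is at most \<open>E0\<close> and
        \<open>D\<close> at most \<open>E0 / T\<close>, so both summands become
        \<open>E0 / sqrt T\<close>.\<close>
      define \<mu> where "\<mu> = 1 / sqrt T"
      have mu: "\<mu> > 0" using T_pos by (simp add: \<mu>_def)
      have "m.w z x ^ 3 \<le> 3 / 2 * (\<mu> * m.E z + m.D z / \<mu>)"
        using False z mu by (intro m.w_cube_le) auto
      also have "\<dots> \<le> 3 / 2 * (\<mu> * E0 + \<mu> * E0)"
      proof -
        have "m.D z / \<mu> = \<mu> * (T * m.D z)"
          using T_pos by (simp add: \<mu>_def field_simps)
        also have "\<dots> \<le> \<mu> * E0" using Dz mu by (intro mult_left_mono) auto
        finally have 1: "m.D z / \<mu> \<le> \<mu> * E0" .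
        have 2: "\<mu> * m.E z \<le> \<mu> * E0" using Ez mu by (intro mult_left_mono) auto
        show ?thesis by (rule mult_left_mono[OF add_mono[OF 2 1]]) simp
      qed
      also have "\<dots> = 3 * E0 / sqrt T" by (simp add: \<mu>_def)
      also have "\<dots> \<le> m ^ 3" using m(2) by (simp add: E0_def)
      finally have "m.w z x \<le> m" using m(1) m.w_bounds(1)[of z x] power_mono_iff[of "m.w z x" m 3] by simp
      then have "c - m.a z x \<le> m" by (simp add: m.w_def)
      \<comment> \<open>One \<open>m\<close> bounds the mollified gap, the other the distance
        between \<open>U\<close> and its mollification.\<close>
      then show ?thesis using close[of z x] z d2(3) by (simp add: m.a_def)
    qed
  qed
qed

text \<open>The prescribed \<open>R0\<close> serves the energy: it lets the interval contain the one
  on which the initial gap lives.\<close>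

lemma lower_bound_far:
  assumes lim: "(U 0 \<longlongrightarrow> p) at_top" "(U 0 \<longlongrightarrow> q) at_bot" and pq: "p \<in> {-M..M}" "q \<in> {-M..M}"
    and c: "c < p" "c < q"
  obtains R where "R > 0" "R \<ge> R0" "\<And>t x. \<lbrakk>0 \<le> t; t \<le> T; \<bar>x\<bar> \<ge> R\<rbrakk> \<Longrightarrow> c \<le> U t x"
proof -
  have "\<exists>X. \<forall>x. 1 * x \<ge> X \<longrightarrow> \<bar>U 0 x - p\<bar> \<le> d" if "d > 0" for d
    using tendstoD[OF lim(1) that] by (auto simp: eventually_at_top_linorder dist_real_def intro: less_imp_le)
  from spatial_limit_preserved[OF pq(1) _ this, of "p - c"] c
  obtain X where X: "\<And>t x. \<lbrakk>0 \<le> t; t \<le> T; x \<ge> X\<rbrakk> \<Longrightarrow> \<bar>U t x - p\<bar> \<le> p - c" by auto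
  have "\<exists>X. \<forall>x. (- 1) * x \<ge> X \<longrightarrow> \<bar>U 0 x - q\<bar> \<le> d" if "d > 0" for d
  proof -
    have "\<forall>\<^sub>F x in at_bot. dist (U 0 x) q < d" using tendstoD[OF lim(2)] that by blast
    then obtain N where N: "\<And>x. x \<le> N \<Longrightarrow> dist (U 0 x) q < d"
      by (auto simp: eventually_at_bot_linorder)
    show ?thesis using N by (intro exI[of _ "- N"]) (force simp: dist_real_def)
  qed
  from spatial_limit_preserved[OF pq(2) _ this, of "q - c"] c
  obtain Y where Y: "\<And>t x. \<lbrakk>0 \<le> t; t \<le> T; - x \<ge> Y\<rbrakk> \<Longrightarrow> \<bar>U t x - q\<bar> \<le> q - c" by auto
  define R where "R = Max {X, Y, R0, 1}"
  show ?thesis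
  proof (rule that)
    show "R > 0" "R \<ge> R0" by (auto simp: R_def)
    fix t x assume t: "0 \<le> t" "t \<le> T" and "\<bar>x\<bar> \<ge> R"
    then have "x \<ge> X \<or> - x \<ge> Y" by (auto simp: R_def abs_real_def split: if_splits)
    then show "c \<le> U t x" using X[OF t, of x] Y[OF t, of x] by auto
  qed
qed

lemma mild_flow_uminus: "mild_flow (\<lambda>v. - f (- v)) (\<lambda>s x. - U s x) T M L"
proof unfold_locales
  show "\<exists>d>0. \<forall>s. \<bar>s - s0\<bar> < d \<longrightarrow> (\<forall>x. \<bar>- U s x - - U s0 x\<bar> \<le> e)" if "e > 0" for s0 e
    using U_curve[OF that, of s0] by (simp add: abs_minus_commute)
  show "uniformly_continuous_on UNIV (\<lambda>x. - U s x)" for s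
    by (intro uniformly_continuous_on_minus U_unif_cont)
  show "L-lipschitz_on {-M..M} (\<lambda>v. - f (- v))"
  proof (rule lipschitz_onI)
    fix x y assume xy: "x \<in> {-M..M}" "y \<in> {-M..M}"
    have "\<bar>f (- y) - f (- x)\<bar> \<le> L * \<bar>- y - - x\<bar>" using xy by (intro f_diff_le) auto
    then show "dist (- f (- x)) (- f (- y)) \<le> L * dist x y" by (simp add: dist_real_def)
  qed (rule L_nonneg)
  have neg: "conv k (\<lambda>y. - g y) x = - conv k g x" for k g x by (simp add: conv_def)
  show "- U t x = conv (heat_kernel t) (\<lambda>x. - U 0 x) x +
      (LBINT s:{0..t}. conv (heat_kernel_dx (t - s)) (\<lambda>y. - f (- (- U s y))) x)"
    if "0 < t" "t \<le> T" for t x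
    using mild[OF that, of x] by (simp add: neg set_lebesgue_integral_def)
qed (use T_pos U_bound in auto)

end

section \<open>From mild solutions to bounded time intervals, and conclusion\<close>

lemma clamp_dist: "\<bar>max 0 (min T s) - max 0 (min T s0)\<bar> \<le> \<bar>s - s0 :: real\<bar>"
  by (auto simp: max_def min_def)

lemma curve_C_ub_bounded:
  assumes u: "curve_C_ub u"
  obtains M where "\<And>t x. \<lbrakk>0 \<le> t; t \<le> T\<rbrakk> \<Longrightarrow> \<bar>u t x\<bar> \<le> M"
proof -
  \<comment> \<open>The pair holds a radius and a bound for a neighbourhood of \<open>t0\<close>, so
    that one application of choice delivers both.\<close>
  have "\<exists>q. t0 \<ge> 0 \<longrightarrow> fst q > 0 \<and> (\<forall>t x. 0 \<le> t \<longrightarrow> \<bar>t - t0\<bar> < fst q \<longrightarrow> \<bar>u t x\<bar> \<le> snd q)" for t0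
  proof (cases "t0 \<ge> 0")
    case True
    then have "bounded (range (u t0))" using u by (simp add: curve_C_ub_def C_ub_def)
    then obtain B where B: "\<And>x. \<bar>u t0 x\<bar> \<le> B" by (auto simp: bounded_iff)
    have "\<exists>d>0. \<forall>t\<ge>0. \<bar>t - t0\<bar> < d \<longrightarrow> (\<forall>x. \<bar>u t x - u t0 x\<bar> \<le> 1)"
      using u True zero_less_one unfolding curve_C_ub_def by blast
    then obtain d where d: "d > 0" "\<And>t x. 0 \<le> t \<Longrightarrow> \<bar>t - t0\<bar> < d \<Longrightarrow> \<bar>u t x - u t0 x\<bar> \<le> 1"
      by blast
    have "\<bar>u t x\<bar> \<le> B + 1" if "0 \<le> t" "\<bar>t - t0\<bar> < d" for t x
      using d(2)[OF that, of x] B[of x] by linarith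
    then show ?thesis using d(1) by (intro exI[of _ "(d, B + 1)"]) simp
  qed simp
  then obtain q where q: "\<And>t0. t0 \<ge> 0 \<Longrightarrow> fst (q t0) > 0"
    "\<And>t0 t x. \<lbrakk>t0 \<ge> 0; 0 \<le> t; \<bar>t - t0\<bar> < fst (q t0)\<rbrakk> \<Longrightarrow> \<bar>u t x\<bar> \<le> snd (q t0)"
    by metis
  define d M where "d t = fst (q t)" and "M t = snd (q t)" for t
  have d: "\<And>t0. t0 \<ge> 0 \<Longrightarrow> d t0 > 0"
    and M: "\<And>t0 t x. \<lbrakk>t0 \<ge> 0; 0 \<le> t; \<bar>t - t0\<bar> < d t0\<rbrakk> \<Longrightarrow> \<bar>u t x\<bar> \<le> M t0"
    using q by (simp_all add: d_def M_def)
  obtain N where N: "finite N" "N \<subseteq> {0..T}" "{0..T} \<subseteq> (\<Union>t\<in>N. ball t (d t))"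
  proof (rule compactE_image[of "{0..T}" "{0..T}" "\<lambda>t. ball t (d t)"])
    show "{0..T} \<subseteq> (\<Union>t\<in>{0..T}. ball t (d t))" using d by auto
  qed auto
  show ?thesis
  proof (rule that)
    fix t x assume t: "0 \<le> t" "t \<le> T"
    obtain r where r: "r \<in> N" "t \<in> ball r (d r)" using N(3) t by force
    then have "\<bar>u t x\<bar> \<le> M r" using N(2) t by (intro M) (auto simp: dist_real_def abs_minus_commute)
    also have "\<dots> \<le> Max (M ` N)" using N(1) r by simp
    finally show "\<bar>u t x\<bar> \<le> Max (M ` N)" .
  qed
qed

text \<open>Clamping time to \<open>[0,T]\<close> leaves the equation there unchanged. The
  prescribed \<open>K\<close> lets \<open>[-M,M]\<close> also contain the limits at infinity, where
  \<open>f\<close> is compared with its values along the solution.\<close>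

lemma mild_solution_mild_flow:
  assumes f: "locally_lipschitz f" and u: "mild_solution f u0 u" and T: "T > 0"
  obtains M L where "M \<ge> K" "mild_flow f (\<lambda>s. u (max 0 (min T s))) T M L"
proof -
  have curve: "curve_C_ub u" using u by (simp add: mild_solution_def)
  obtain M' where M': "\<And>t x. \<lbrakk>0 \<le> t; t \<le> T\<rbrakk> \<Longrightarrow> \<bar>u t x\<bar> \<le> M'"
    using curve_C_ub_bounded[OF curve] by blast
  define M where "M = max K M'"
  have M: "\<bar>u t x\<bar> \<le> M" if "0 \<le> t" "t \<le> T" for t x using M'[OF that, of x] by (simp add: M_def)
  obtain L where L: "L-lipschitz_on {-M..M} f" using f unfolding locally_lipschitz_def by blast
  have ucont: "uniformly_continuous_on UNIV (u t)" if "t \<ge> 0" for t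
    using curve that unfolding curve_C_ub_def C_ub_def by blast
  have F: "(\<lambda>y. f (u t y)) \<in> borel_measurable borel" "\<exists>B. \<forall>y. \<bar>f (u t y)\<bar> \<le> B"
    if t: "0 \<le> t" "t \<le> T" for t
  proof -
    have mem: "u t y \<in> {-M..M}" for y using M[OF t, of y] by (simp add: abs_le_iff)
    have "continuous_on UNIV (\<lambda>y. f (u t y))"
      by (rule continuous_on_compose2[OF lipschitz_on_continuous_on[OF L]
            uniformly_continuous_imp_continuous[OF ucont[OF t(1)]]]) (use mem in auto)
    then show "(\<lambda>y. f (u t y)) \<in> borel_measurable borel" by (rule borel_measurable_continuous_onI)
    have "bounded (f ` {-M..M})"
      by (intro compact_imp_bounded compact_continuous_image lipschitz_on_continuous_on[OF L]) simp
    then obtain B where B: "\<forall>v\<in>f ` {-M..M}. norm v \<le> B" unfolding bounded_iff by blast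
    have "\<bar>f (u t y)\<bar> \<le> B" for y using bspec[OF B imageI[OF mem[of y]]] by simp
    then show "\<exists>B. \<forall>y. \<bar>f (u t y)\<bar> \<le> B" by (intro exI allI)
  qed
  have "mild_flow f (\<lambda>s. u (max 0 (min T s))) T M L"
  proof unfold_locales
    show "\<exists>d>0. \<forall>s. \<bar>s - s0\<bar> < d \<longrightarrow> (\<forall>x. \<bar>u (max 0 (min T s)) x - u (max 0 (min T s0)) x\<bar> \<le> e)"
      if "e > 0" for s0 e
    proof -
      have "0 \<le> max 0 (min T s0)" by simp
      with curve that
      have "\<exists>d>0. \<forall>t\<ge>0. \<bar>t - max 0 (min T s0)\<bar> < d \<longrightarrow> (\<forall>x. \<bar>u t x - u (max 0 (min T s0)) x\<bar> \<le> e)"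
        unfolding curve_C_ub_def by blast
      then obtain d where d: "d > 0" "\<And>t x. 0 \<le> t \<Longrightarrow> \<bar>t - max 0 (min T s0)\<bar> < d \<Longrightarrow> \<bar>u t x - u (max 0 (min T s0)) x\<bar> \<le> e"
        by blast
      have "\<bar>u (max 0 (min T s)) x - u (max 0 (min T s0)) x\<bar> \<le> e" if "\<bar>s - s0\<bar> < d" for s x
        by (rule d(2)[OF max.cobounded1 le_less_trans[OF clamp_dist that]])
      then show ?thesis using d(1) by blast
    qed
    show "\<bar>u (max 0 (min T s)) x\<bar> \<le> M" for s x using T by (intro M) auto
    show "uniformly_continuous_on UNIV (u (max 0 (min T s)))" for s by (rule ucont) simp
    fix t x :: real assume t: "0 < t" "t \<le> T"
    have "u t x = heat_sg t u0 x + (LBINT s:{0..t}. deriv (heat_sg (t - s) (\<lambda>y. f (u s y))) x)"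
      using u t by (simp add: mild_solution_def)
    also have "(LBINT s:{0..t}. deriv (heat_sg (t - s) (\<lambda>y. f (u s y))) x)
        = (LBINT s:{0..t}. conv (heat_kernel_dx (t - s)) (\<lambda>y. f (u (max 0 (min T s)) y)) x)"
    proof (rule set_lebesgue_integral_cong; (intro allI impI)?)
      fix s assume s: "s \<in> {0..t}"
      then have clamp: "max 0 (min T s) = s" using t by auto
      show "deriv (heat_sg (t - s) (\<lambda>y. f (u s y))) x = conv (heat_kernel_dx (t - s)) (\<lambda>y. f (u (max 0 (min T s)) y)) x"
      proof (cases "s = t")
        case True
        \<comment> \<open>At \<open>s = t\<close> both sides are 0: division by zero makes the
          kernel and its derivative vanish at time 0.\<close>
        have "heat_sg 0 g = (\<lambda>_. 0)" for g by (simp add: fun_eq_iff heat_sg_def heat_kernel_def)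
        then show ?thesis using True by (simp add: conv_def)
      next
        case False
        have s': "0 \<le> s" "s \<le> T" "t - s > 0" using False s t by auto
        obtain B where B: "\<And>y. \<bar>f (u s y)\<bar> \<le> B" using F(2)[OF s'(1,2)] by blast
        show ?thesis unfolding clamp heat_sg_eq_conv
          by (rule DERIV_imp_deriv[OF heat_conv_has_derivative_x(1)[OF s'(3) F(1)[OF s'(1,2)] B]])
      qed
    qed simp
    finally show "u (max 0 (min T t)) x = conv (heat_kernel t) (u (max 0 (min T 0))) x +
        (LBINT s:{0..t}. conv (heat_kernel_dx (t - s)) (\<lambda>y. f (u (max 0 (min T s)) y)) x)"
      using t u by (simp add: heat_sg_eq_conv mild_solution_def)
  qed (use T L in auto)
  then show ?thesis using that[of M L] by (simp add: M_def)
qed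

text \<open>Stated for curves that are flows on every time horizon rather than for mild solutions,
  so that the reflected curve \<open>- u\<close> is covered as well.\<close>

lemma eventually_positive:
  fixes u :: "real \<Rightarrow> real \<Rightarrow> real"
  assumes flow: "\<And>T K. T > 0 \<Longrightarrow> \<exists>M L. M \<ge> K \<and> mild_flow f (\<lambda>s. u (max 0 (min T s))) T M L"
    and lim: "(u 0 \<longlongrightarrow> p) at_top" "(u 0 \<longlongrightarrow> q) at_bot" and pos: "p > 0" "q > 0"
  shows "\<exists>T>0. \<forall>t>T. \<forall>x. u t x > 0"
proof -
  define c where "c = min p q / 2"
  have c: "c > 0" "3 / 2 * c < p" "3 / 2 * c < q" using pos by (auto simp: c_def min_def)
  have far: "\<exists>R L M. R > 0 \<and> R \<ge> R0 \<and> mild_flow f (\<lambda>s. u (max 0 (min T s))) T M L \<and>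
      (\<forall>t x. 0 \<le> t \<longrightarrow> t \<le> T \<longrightarrow> \<bar>x\<bar> \<ge> R \<longrightarrow> 3 / 2 * c \<le> u t x)" if T: "T > 0" for T R0
  proof -
    obtain M L where M: "M \<ge> max p q" and flow: "mild_flow f (\<lambda>s. u (max 0 (min T s))) T M L"
      using flow[OF T, of "max p q"] by blast
    interpret mild_flow f "\<lambda>s. u (max 0 (min T s))" T M L by (rule flow)
    have "p \<in> {-M..M}" "q \<in> {-M..M}" using pos M by auto
    moreover have "((\<lambda>x. u (max 0 (min T 0)) x) \<longlongrightarrow> p) at_top" "((\<lambda>x. u (max 0 (min T 0)) x) \<longlongrightarrow> q) at_bot"
      using lim T by auto
    ultimately obtain R where R: "R > 0" "R \<ge> R0"
      "\<And>t x. \<lbrakk>0 \<le> t; t \<le> T; \<bar>x\<bar> \<ge> R\<rbrakk> \<Longrightarrow> 3 / 2 * c \<le> u (max 0 (min T t)) x"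
      using lower_bound_far[of p q "3 / 2 * c" R0] c by blast
    have "3 / 2 * c \<le> u t x" if "0 \<le> t" "t \<le> T" "\<bar>x\<bar> \<ge> R" for t x
      using R(3)[OF that] that by simp
    then show ?thesis using R flow by blast
  qed
  obtain R0 where R0: "R0 > 0" "\<And>x. \<bar>x\<bar> \<ge> R0 \<Longrightarrow> c \<le> u 0 x"
    using far[of 1 0] c(1) by force
  define h where "h x = max 0 (c - u 0 x) ^ 3" for x
  define E0 where "E0 = integral {-R0..R0} h"
  \<comment> \<open>With this choice \<open>c - 2 * m = c / 2\<close>, and the square in
    \<open>T\<close> solves \<open>3 * (\<bar>E0\<bar> + 2) / sqrt T = m ^ 3\<close>.\<close>
  define m where "m = c / 4"
  have m: "m > 0" using c by (simp add: m_def)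
  define T where "T = (3 * (\<bar>E0\<bar> + 2) / m ^ 3)\<^sup>2"
  have T: "T > 0" using m by (simp add: T_def)
  have sT: "sqrt T = 3 * (\<bar>E0\<bar> + 2) / m ^ 3" using m by (simp add: T_def)
  obtain R M L where R: "R > 0" "R \<ge> R0" and flowT: "mild_flow f (\<lambda>s. u (max 0 (min T s))) T M L"
    and farT: "\<And>t x. \<lbrakk>0 \<le> t; t \<le> T; \<bar>x\<bar> \<ge> R\<rbrakk> \<Longrightarrow> 3 / 2 * c \<le> u t x"
    using far[OF T, of R0] by blast
  interpret mild_flow f "\<lambda>s. u (max 0 (min T s))" T M L by (rule flowT)
  have u0: "(\<lambda>x. u (max 0 (min T 0)) x) = u 0" using T by simp
  \<comment> \<open>The initial gap vanishes outside \<open>[-R0,R0]\<close>, so the larger interval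
    does not change the energy from which \<open>T\<close> was computed.\<close>
  have "energy c R 0 = E0"
  proof -
    have cont: "continuous_on {-R0..R0} h"
      unfolding h_def using U_continuous_x[of "{-R0..R0}" 0] T by (intro continuous_intros) simp
    have "(h has_integral E0) {-R0..R0}"
      unfolding E0_def by (intro integrable_integral integrable_continuous_real cont)
    then have "(h has_integral E0) {-R..R}"
      by (rule has_integral_on_superset) (use R R0(2) in \<open>auto simp: h_def abs_le_iff not_le\<close>)
    then show ?thesis unfolding energy_def h_def[abs_def] u0[unfolded fun_eq_iff, rule_format]
      by (rule integral_unique)
  qed
  then have "m ^ 3 \<ge> 3 * (energy c R 0 + 2) / sqrt T"
    unfolding sT using m by (simp add: field_simps)
  moreover have "c < 3 / 2 * c" using c by simp
  moreover have "3 / 2 * c \<le> u (max 0 (min T t)) x" if "0 \<le> t" "t \<le> T" "\<bar>x\<bar> \<ge> R" for t x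
    using farT[OF that] that by simp
  ultimately obtain z where z: "0 < z" "z < T" "\<And>x. c - 2 * m \<le> u (max 0 (min T z)) x"
    using lower_bound_attained[OF R(1), of "3 / 2 * c" c m] m by blast
  have z': "c / 2 \<le> u z x" for x using z(3)[of x] z by (simp add: m_def)
  have "u t x > 0" if t: "t > T" for t x
  proof -
    have t0: "t > 0" using t T by simp
    \<comment> \<open>The horizon \<open>t\<close> has its own \<open>R'\<close>, \<open>M'\<close>
      and \<open>L'\<close>; the level \<open>c / 2\<close> carried from \<open>z\<close> to
      \<open>t\<close> does not depend on them.\<close>
    obtain R' M' L' where R': "R' > 0" and flow': "mild_flow f (\<lambda>s. u (max 0 (min t s))) t M' L'"
      and far': "\<And>s x. \<lbrakk>0 \<le> s; s \<le> t; \<bar>x\<bar> \<ge> R'\<rbrakk> \<Longrightarrow> 3 / 2 * c \<le> u s x"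
      using far[OF t0, of 0] by blast
    interpret f': mild_flow f "\<lambda>s. u (max 0 (min t s))" t M' L' by (rule flow')
    have "c / 2 \<le> u (max 0 (min t t)) x"
      by (rule f'.lower_bound_preserved[OF R', of "3 / 2 * c" _ z]) (use far' z z' t c in auto)
    then show ?thesis using c t0 by simp
  qed
  then show ?thesis using T by blast
qed

theorem theorem3p5:
  fixes f u0 :: "real \<Rightarrow> real" and u :: "real \<Rightarrow> real \<Rightarrow> real" and phip phim :: real
  assumes "locally_lipschitz f"
    and "C1_ub u0"
    and "(u0 \<longlongrightarrow> phip) at_top" and "(u0 \<longlongrightarrow> phim) at_bot"
    and "phip \<noteq> 0" and "phim \<noteq> 0" and "sgn phip = sgn phim"
    and "mild_solution f u0 u"
  shows "\<exists>T>0. \<forall>t>T. \<forall>x. u t x \<noteq> 0"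
proof -
  have u0: "u 0 = u0" using assms(8) by (simp add: mild_solution_def)
  have flow: "\<exists>M L. M \<ge> K \<and> mild_flow f (\<lambda>s. u (max 0 (min T s))) T M L" if "T > 0" for T K
    using mild_solution_mild_flow[OF assms(1,8) that] by metis
  consider "phip > 0" "phim > 0" | "phip < 0" "phim < 0"
    using assms(5-7) by (auto simp: sgn_if split: if_splits)
  then show ?thesis
  proof cases
    case 1
    have "\<exists>T>0. \<forall>t>T. \<forall>x. u t x > 0"
      using eventually_positive[OF flow] assms(3,4) 1 u0 by blast
    then show ?thesis by (metis less_irrefl)
  next
    case 2
    have "\<exists>M L. M \<ge> K \<and> mild_flow (\<lambda>v. - f (- v)) (\<lambda>s x. - u (max 0 (min T s)) x) T M L" if "T > 0" for T K
      using flow[OF that, of K] mild_flow.mild_flow_uminus by blast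
    moreover have "((\<lambda>x. - u 0 x) \<longlongrightarrow> - phip) at_top" "((\<lambda>x. - u 0 x) \<longlongrightarrow> - phim) at_bot"
      unfolding u0 by (intro tendsto_minus assms)+
    ultimately have "\<exists>T>0. \<forall>t>T. \<forall>x. - u t x > 0"
      using 2 by (intro eventually_positive[of "\<lambda>v. - f (- v)" "\<lambda>s x. - u s x" "- phip" "- phim"]) auto
    then show ?thesis by (metis less_irrefl neg_0_less_iff_less)
  qed
qed

end
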